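(* Let $C$ be a smooth projective curve, let $n>0$, and let $D=\sum_{i=1}^na_i-\sum_{i=1}^nb_i$ be a divisor on $C$, with $a_1,\dots,a_n,b_1,\dots,b_n$ distinct points, such that $[D]$ has order $2$ in $Pic(C)$; let $f$ be a rational function on $C$ with $\mathrm{div}(f)=2D$. Let $E$ be the set of embeddings $e:C\to C^{n+1}$ such that the composition of $e$ with the projection to any factor is either the identity map or is constant with image equal to one of the $a_i$'s or $b_i$'s, and for $e\in E$ let $f_e$ be the function $f$ considered as a function on $e(C)$. Consider the following group actions on $E$: (i) $\Sigma_{n+1}$ acting by permuting the factors of $C^{n+1}$; (ii) $\Sigma_n$ acting by permuting the $a_i$'s; (iii) $\Sigma_n$ acting by permuting the $b_i$'s; (iv) $\mathbb{Z}/2$ acting by switching $a_i$ and $b_i$ for all $i$. Then for every $n>0$ the set of higher Chow $1$-cycles of the form $\sum_{e\in E}m_e\,(e(C)\otimes f_e)$, $m_e\in\mathbb{Q}$, invariant under the action on $E$ of $\Sigma_{n+1}$ permuting the factors of $C^{n+1}$, the action of $\Sigma_n$ permuting the $a_i$'s, the action of $\Sigma_n$ permuting the $b_i$'s, and the action of $\mathbb{Z}/2$ switching $a_i$ and $b_i$ for all $i$, is a positive dimensional $\mathbb{Q}$-vector space.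
   Context: Varieties are over $\mathbb{C}$. $\Sigma_k$ is the symmetric group on $k$ letters. A higher Chow $1$-cycle on $C^{n+1}$ of the displayed form is a formal sum $\sum_e m_e(e(C)\otimes f_e)$ (curves with rational functions, $\mathbb{Q}$-coefficients) with $\sum_e m_e\,\mathrm{div}(f_e)=0$ as a zero-cycle on $C^{n+1}$ with $\mathbb{Q}$-coefficients. Invariance means that the coefficients satisfy $m_{\gamma e}=m_e$ for all $e\in E$ and all $\gamma$ in each of the groups. *)

theory Defs
  imports "HOL-Analysis.Analysis" "HOL-Algebra.Free_Abelian_Groups"
    "HOL-Algebra.Multiplicative_Group" "HOL-Combinatorics.Permutations"
begin

section \<open>Spaces with functions\<close>

text \<open>
  Varieties are classical varieties over the complex numbers: a set of closed points with its
  Zariski topology and its sheaf of regular functions.  A regular function on \<open>U\<close> is represented by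
  a total function of which only the values on \<open>U\<close> matter; the sections over \<open>U\<close> are meaningful
  only for open \<open>U\<close>.
\<close>

record 'a fspace =
  zariski :: "'a topology"
  regular :: "'a set \<Rightarrow> ('a \<Rightarrow> complex) set"

abbreviation points :: "'a fspace \<Rightarrow> 'a set" where
  "points X \<equiv> topspace (zariski X)"

text \<open>The reduced induced structure on a (locally) closed set of points.\<close>

definition induced :: "'a fspace \<Rightarrow> 'a set \<Rightarrow> 'a fspace" where
  "induced X Z = \<lparr>
     zariski = subtopology (zariski X) Z,
     regular = (\<lambda>U. {f. \<forall>p\<in>U. \<exists>W. openin (zariski X) W \<and> p \<in> W \<and>
                         (\<exists>g\<in>regular X W. \<forall>x\<in>W \<inter> U. f x = g x)})\<rparr>"

definition morphism :: "'a fspace \<Rightarrow> 'b fspace \<Rightarrow> ('a \<Rightarrow> 'b) \<Rightarrow> bool" where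
  "morphism X Y \<phi> \<longleftrightarrow>
     continuous_map (zariski X) (zariski Y) \<phi> \<and>
     (\<forall>V. openin (zariski Y) V \<longrightarrow>
        (\<forall>g\<in>regular Y V. g \<circ> \<phi> \<in> regular X {x \<in> points X. \<phi> x \<in> V}))"

definition isomorphism :: "'a fspace \<Rightarrow> 'b fspace \<Rightarrow> ('a \<Rightarrow> 'b) \<Rightarrow> bool" where
  "isomorphism X Y \<phi> \<longleftrightarrow>
     morphism X Y \<phi> \<and>
     (\<exists>\<psi>. morphism Y X \<psi> \<and> (\<forall>x\<in>points X. \<psi> (\<phi> x) = x) \<and> (\<forall>y\<in>points Y. \<phi> (\<psi> y) = y))"

definition closed_embedding :: "'a fspace \<Rightarrow> 'b fspace \<Rightarrow> ('a \<Rightarrow> 'b) \<Rightarrow> bool" where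
  "closed_embedding X Y e \<longleftrightarrow>
     closedin (zariski Y) (e ` points X) \<and> isomorphism X (induced Y (e ` points X)) e"

text \<open>
  The product variety of copies of \<open>X\<close> indexed by \<open>I\<close>.  On a box \<open>\<Prod>\<^sub>i U i\<close> of open sets, the
  functions \<open>box_function X I U\<close> form the algebra generated by the pullbacks of regular functions on
  the \<open>U i\<close> (the image of their tensor product).  The Zariski topology of the product, which is finer
  than the product topology, has as basis their nonvanishing loci, and its regular functions
  are locally quotients of them.
\<close>

inductive box_function ::
  "'a fspace \<Rightarrow> 'i set \<Rightarrow> ('i \<Rightarrow> 'a set) \<Rightarrow> (('i \<Rightarrow> 'a) \<Rightarrow> complex) \<Rightarrow> bool"
  for X I U where
  const: "box_function X I U (\<lambda>x. c)"
| pullback: "i \<in> I \<Longrightarrow> f \<in> regular X (U i) \<Longrightarrow> box_function X I U (\<lambda>x. f (x i))"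
| add: "box_function X I U g \<Longrightarrow> box_function X I U h \<Longrightarrow> box_function X I U (\<lambda>x. g x + h x)"
| mult: "box_function X I U g \<Longrightarrow> box_function X I U h \<Longrightarrow> box_function X I U (\<lambda>x. g x * h x)"

definition power_space :: "'a fspace \<Rightarrow> 'i set \<Rightarrow> ('i \<Rightarrow> 'a) fspace" where
  "power_space X I = \<lparr>
     zariski = topology_generated_by
       {{x \<in> Pi\<^sub>E I U. h x \<noteq> 0} | U h. (\<forall>i\<in>I. openin (zariski X) (U i)) \<and> box_function X I U h},
     regular = (\<lambda>W. {f. \<forall>p\<in>W. \<exists>U g h.
       (\<forall>i\<in>I. openin (zariski X) (U i)) \<and> box_function X I U g \<and> box_function X I U h \<and>
       p \<in> Pi\<^sub>E I U \<and> h p \<noteq> 0 \<and>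
       (\<forall>x\<in>W \<inter> Pi\<^sub>E I U. h x \<noteq> 0 \<longrightarrow> f x = g x / h x)})\<rparr>"


section \<open>Projective space and smooth projective curves\<close>

text \<open>The type \<open>'n proj\<close> is complex projective space of dimension \<open>CARD('n) - 1\<close>.\<close>

typedef ('n::finite) proj = "{L :: (complex^'n) set. vec.subspace L \<and> vec.dim L = 1}"
proof
  show "vec.span {axis undefined 1 :: complex^'n}
      \<in> {L :: (complex^'n) set. vec.subspace L \<and> vec.dim L = 1}"
    by (simp add: vec.dim_span axis_eq_0_iff)
qed

definition hom_coords :: "'n::finite proj \<Rightarrow> (complex^'n) set" where
  "hom_coords p = Rep_proj p - {0}"

text \<open>
  Forms of degree \<open>d\<close> in the homogeneous coordinates; since the field is infinite they may be
  identified with the functions they define.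
\<close>

inductive form :: "nat \<Rightarrow> (complex^'n \<Rightarrow> complex) \<Rightarrow> bool" where
  const: "form 0 (\<lambda>v. c)"
| coord: "form 1 (\<lambda>v. v $ i)"
| add: "form d F \<Longrightarrow> form d G \<Longrightarrow> form d (\<lambda>v. F v + G v)"
| mult: "form d F \<Longrightarrow> form d' G \<Longrightarrow> form (d + d') (\<lambda>v. F v * G v)"

definition proj_zariski :: "'n::finite proj topology" where
  "proj_zariski = topology_generated_by {{p. \<forall>v\<in>hom_coords p. F v \<noteq> 0} | d F. form d F}"

definition proj_space :: "'n::finite proj fspace" where
  "proj_space = \<lparr>
     zariski = proj_zariski,
     regular = (\<lambda>U. {f. \<forall>p\<in>U. \<exists>W d F G.
       openin proj_zariski W \<and> p \<in> W \<and> form d F \<and> form d G \<and>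
       (\<forall>q\<in>W \<inter> U. \<forall>v\<in>hom_coords q. G v \<noteq> 0 \<and> f q = F v / G v)})\<rparr>"

definition irreducible_top :: "'a topology \<Rightarrow> bool" where
  "irreducible_top T \<longleftrightarrow> topspace T \<noteq> {} \<and>
     (\<forall>A B. closedin T A \<and> closedin T B \<and> A \<union> B = topspace T \<longrightarrow>
        A = topspace T \<or> B = topspace T)"

definition krull_dim :: "'a topology \<Rightarrow> enat" where
  "krull_dim T = Sup {enat k | k. \<exists>Z :: nat \<Rightarrow> 'a set.
     (\<forall>i\<le>k. closedin T (Z i) \<and> irreducible_top (subtopology T (Z i))) \<and>
     (\<forall>i<k. Z i \<subset> Z (Suc i))}"

text \<open>
  The kernel, at the homogeneous coordinates \<open>v\<close> of a point of \<open>C\<close>, of the Jacobian matrix of the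
  homogeneous ideal of \<open>C\<close>.
\<close>

definition cone_tangent_space :: "'n::finite proj set \<Rightarrow> complex^'n \<Rightarrow> (complex^'n) set" where
  "cone_tangent_space C v =
     {w. \<forall>d F. form d F \<and> (\<forall>q\<in>C. \<forall>u\<in>hom_coords q. F u = 0) \<longrightarrow>
           deriv (\<lambda>t. F (v + t *s w)) 0 = 0}"

text \<open>
  Smoothness is the Jacobian criterion: the affine cone over a curve has dimension 2, so a point
  is smooth iff the kernel of the Jacobian matrix has dimension 2.
\<close>

definition smooth_projective_curve :: "'n::finite proj set \<Rightarrow> bool" where
  "smooth_projective_curve C \<longleftrightarrow>
     closedin (zariski proj_space) C \<and>
     irreducible_top (subtopology (zariski proj_space) C) \<and>
     krull_dim (subtopology (zariski proj_space) C) = 1 \<and>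
     (\<forall>p\<in>C. \<forall>v\<in>hom_coords p. vec.dim (cone_tangent_space C v) = 2)"

abbreviation proj_variety :: "'n::finite proj set \<Rightarrow> 'n proj fspace" where
  "proj_variety C \<equiv> induced proj_space C"


section \<open>Rational functions, divisors and the Picard group\<close>

text \<open>
  A rational function on an irreducible variety is an equivalence class of pairs of a nonempty open
  set and a regular function on it.
\<close>

type_synonym 'a rat_fun = "('a set \<times> ('a \<Rightarrow> complex)) set"

definition rat_reps :: "'a fspace \<Rightarrow> ('a set \<times> ('a \<Rightarrow> complex)) set" where
  "rat_reps X = {(U, f). openin (zariski X) U \<and> U \<noteq> {} \<and> f \<in> regular X U}"

definition rat_rel ::
  "'a fspace \<Rightarrow> (('a set \<times> ('a \<Rightarrow> complex)) \<times> ('a set \<times> ('a \<Rightarrow> complex))) set" where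
  "rat_rel X = {((U, f), (V, g)). (U, f) \<in> rat_reps X \<and> (V, g) \<in> rat_reps X \<and>
                   (\<forall>x\<in>U \<inter> V. f x = g x)}"

definition function_field :: "'a fspace \<Rightarrow> 'a rat_fun set" where
  "function_field X = rat_reps X // rat_rel X"

definition zero_rat :: "'a fspace \<Rightarrow> 'a rat_fun" where
  "zero_rat X = rat_rel X `` {(points X, \<lambda>x. 0)}"

text \<open>A generator of the maximal ideal of the local ring at \<open>p\<close>, defined on \<open>U\<close>.\<close>

definition uniformizer :: "'a fspace \<Rightarrow> 'a \<Rightarrow> 'a set \<Rightarrow> ('a \<Rightarrow> complex) \<Rightarrow> bool" where
  "uniformizer X p U t \<longleftrightarrow>
     openin (zariski X) U \<and> p \<in> U \<and> t \<in> regular X U \<and> t p = 0 \<and>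
     (\<forall>V g. openin (zariski X) V \<and> p \<in> V \<and> g \<in> regular X V \<and> g p = 0 \<longrightarrow>
        (\<exists>W h. openin (zariski X) W \<and> p \<in> W \<and> W \<subseteq> U \<inter> V \<and> h \<in> regular X W \<and>
               (\<forall>x\<in>W. g x = t x * h x)))"

text \<open>
  The order at a smooth point \<open>p\<close> of a curve of a nonzero rational function: the integer \<open>k\<close> such
  that the function is \<open>t\<^sup>k u\<close> for a uniformizer \<open>t\<close> and a unit \<open>u\<close> of the local ring.
\<close>

definition ord_at :: "'a fspace \<Rightarrow> 'a \<Rightarrow> 'a rat_fun \<Rightarrow> int" where
  "ord_at X p \<phi> = (THE k. \<exists>U t W u V f.
     uniformizer X p U t \<and>
     openin (zariski X) W \<and> p \<in> W \<and> W \<subseteq> U \<and> u \<in> regular X W \<and> (\<forall>x\<in>W. u x \<noteq> 0) \<and>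
     (V, f) \<in> \<phi> \<and> (\<forall>x\<in>V \<inter> W. t x \<noteq> 0 \<longrightarrow> f x = t x powi k * u x))"

definition divisor_of :: "'a fspace \<Rightarrow> 'a rat_fun \<Rightarrow> 'a \<Rightarrow> int" where
  "divisor_of X \<phi> p = (if p \<in> points X then ord_at X p \<phi> else 0)"

abbreviation Div :: "'a fspace \<Rightarrow> ('a \<Rightarrow>\<^sub>0 int) monoid" where
  "Div X \<equiv> free_Abelian_group (points X)"

definition principal_divisors :: "'a fspace \<Rightarrow> ('a \<Rightarrow>\<^sub>0 int) set" where
  "principal_divisors X =
     {D \<in> carrier (Div X). \<exists>\<phi>\<in>function_field X - {zero_rat X}.
        Poly_Mapping.lookup D = divisor_of X \<phi>}"

definition Pic :: "'a fspace \<Rightarrow> ('a \<Rightarrow>\<^sub>0 int) set monoid" where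
  "Pic X = Div X Mod principal_divisors X"

definition divisor_class :: "'a fspace \<Rightarrow> ('a \<Rightarrow>\<^sub>0 int) \<Rightarrow> ('a \<Rightarrow>\<^sub>0 int) set" where
  "divisor_class X D = principal_divisors X #>\<^bsub>Div X\<^esub> D"


section \<open>Formal sums of curves with rational functions\<close>

type_synonym 'a formal_sum = "('a set \<times> 'a rat_fun) \<Rightarrow>\<^sub>0 rat"

definition rat_scale :: "rat \<Rightarrow> ('b \<Rightarrow>\<^sub>0 rat) \<Rightarrow> ('b \<Rightarrow>\<^sub>0 rat)" where
  "rat_scale q z = Poly_Mapping.map ((*) q) z"

lemma lookup_rat_scale [simp]:
  "Poly_Mapping.lookup (rat_scale q z) k = q * Poly_Mapping.lookup z k"
  by (simp add: rat_scale_def Poly_Mapping.map.rep_eq when_def)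

lemma vector_space_rat_scale: "vector_space rat_scale"
  by unfold_locales (auto intro!: poly_mapping_eqI simp: lookup_add algebra_simps)

text \<open>
  The zero-cycle \<open>\<Sum> m\<^sub>Z div(g)\<close> on \<open>Y\<close> of a formal sum of curves \<open>Z\<close> in \<open>Y\<close> with rational
  functions \<open>g\<close> on \<open>Z\<close>.
\<close>

definition boundary :: "'a fspace \<Rightarrow> 'a formal_sum \<Rightarrow> 'a \<Rightarrow> rat" where
  "boundary Y z x = (\<Sum>(Z, g)\<in>Poly_Mapping.keys z.
     Poly_Mapping.lookup z (Z, g) * of_int (divisor_of (induced Y Z) g x))"

definition higher_chow_cycle :: "'a fspace \<Rightarrow> 'a formal_sum \<Rightarrow> bool" where
  "higher_chow_cycle Y z \<longleftrightarrow> (\<forall>x\<in>points Y. boundary Y z x = 0)"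


section \<open>Coordinate embeddings and the group actions\<close>

text \<open>The factors of \<open>C\<^bsup>n+1\<^esup>\<close> are indexed by \<open>{..n}\<close>.\<close>

abbreviation curve_power :: "'n::finite proj set \<Rightarrow> nat \<Rightarrow> (nat \<Rightarrow> 'n proj) fspace" where
  "curve_power C n \<equiv> power_space (proj_variety C) {..n}"

definition coord_embeddings ::
  "'n::finite proj set \<Rightarrow> nat \<Rightarrow> 'n proj set \<Rightarrow> ('n proj \<Rightarrow> nat \<Rightarrow> 'n proj) set" where
  "coord_embeddings C n S =
     {e \<in> C \<rightarrow>\<^sub>E points (curve_power C n).
        closed_embedding (proj_variety C) (curve_power C n) e \<and>
        (\<forall>j\<le>n. (\<forall>p\<in>C. e p j = p) \<or> (\<exists>c\<in>S. \<forall>p\<in>C. e p j = c))}"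

text \<open>The rational function on the image of \<open>e\<close> that corresponds to \<open>\<phi>\<close> under \<open>e\<close>.\<close>

definition transport_rat ::
  "'a fspace \<Rightarrow> 'b fspace \<Rightarrow> ('a \<Rightarrow> 'b) \<Rightarrow> 'a rat_fun \<Rightarrow> 'b rat_fun" where
  "transport_rat X Y e \<phi> =
     {(V, g) \<in> rat_reps (induced Y (e ` points X)). ({x \<in> points X. e x \<in> V}, g \<circ> e) \<in> \<phi>}"

definition embedding_sum ::
  "'n::finite proj set \<Rightarrow> nat \<Rightarrow> 'n proj rat_fun \<Rightarrow> ('n proj \<Rightarrow> nat \<Rightarrow> 'n proj) set \<Rightarrow>
     (('n proj \<Rightarrow> nat \<Rightarrow> 'n proj) \<Rightarrow> rat) \<Rightarrow> (nat \<Rightarrow> 'n proj) formal_sum" where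
  "embedding_sum C n f E m =
     (\<Sum>e\<in>E. Poly_Mapping.single
        (e ` C, transport_rat (proj_variety C) (curve_power C n) e f) (m e))"

definition permute_factors ::
  "'a set \<Rightarrow> (nat \<Rightarrow> nat) \<Rightarrow> ('a \<Rightarrow> nat \<Rightarrow> 'a) \<Rightarrow> ('a \<Rightarrow> nat \<Rightarrow> 'a)" where
  "permute_factors C \<sigma> e = (\<lambda>p\<in>C. \<lambda>j. e p (inv_into UNIV \<sigma> j))"

text \<open>
  A permutation \<open>\<tau>\<close> of the points \<open>a\<^sub>i, b\<^sub>i\<close> acts on embeddings through the values of the
  constant coordinates; the identity coordinates are kept.
\<close>

definition relabel ::
  "'a set \<Rightarrow> nat \<Rightarrow> ('a \<Rightarrow> 'a) \<Rightarrow> ('a \<Rightarrow> nat \<Rightarrow> 'a) \<Rightarrow> ('a \<Rightarrow> nat \<Rightarrow> 'a)" where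
  "relabel C n \<tau> e =
     (\<lambda>p\<in>C. \<lambda>j\<in>{..n}. if \<forall>q\<in>C. e q j = q then p else \<tau> (e p j))"

definition permute_family :: "'i set \<Rightarrow> ('i \<Rightarrow> 'a) \<Rightarrow> ('i \<Rightarrow> 'i) \<Rightarrow> 'a \<Rightarrow> 'a" where
  "permute_family I a \<sigma> c = (if c \<in> a ` I then a (\<sigma> (inv_into I a c)) else c)"

definition switch_families :: "'i set \<Rightarrow> ('i \<Rightarrow> 'a) \<Rightarrow> ('i \<Rightarrow> 'a) \<Rightarrow> 'a \<Rightarrow> 'a" where
  "switch_families I a b c =
     (if c \<in> a ` I then b (inv_into I a c)
      else if c \<in> b ` I then a (inv_into I b c) else c)"

definition invariant_coefficients ::
  "'a set \<Rightarrow> nat \<Rightarrow> (nat \<Rightarrow> 'a) \<Rightarrow> (nat \<Rightarrow> 'a) \<Rightarrow> ('a \<Rightarrow> nat \<Rightarrow> 'a) set \<Rightarrow>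
     (('a \<Rightarrow> nat \<Rightarrow> 'a) \<Rightarrow> rat) \<Rightarrow> bool" where
  "invariant_coefficients C n a b E m \<longleftrightarrow>
     (\<forall>e\<in>E.
        (\<forall>\<sigma>. \<sigma> permutes {..n} \<longrightarrow> m (permute_factors C \<sigma> e) = m e) \<and>
        (\<forall>\<sigma>. \<sigma> permutes {1..n} \<longrightarrow> m (relabel C n (permute_family {1..n} a \<sigma>) e) = m e) \<and>
        (\<forall>\<sigma>. \<sigma> permutes {1..n} \<longrightarrow> m (relabel C n (permute_family {1..n} b \<sigma>) e) = m e) \<and>
        m (relabel C n (switch_families {1..n} a b) e) = m e)"

definition invariant_cycles ::
  "'n::finite proj set \<Rightarrow> nat \<Rightarrow> (nat \<Rightarrow> 'n proj) \<Rightarrow> (nat \<Rightarrow> 'n proj) \<Rightarrow> 'n proj rat_fun \<Rightarrow>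
     (nat \<Rightarrow> 'n proj) formal_sum set" where
  "invariant_cycles C n a b f =
     (let E = coord_embeddings C n (a ` {1..n} \<union> b ` {1..n})
      in {embedding_sum C n f E m | m.
            invariant_coefficients C n a b E m \<and>
            higher_chow_cycle (curve_power C n) (embedding_sum C n f E m)})"

end

theory Submission
  imports Defs
begin

text \<open>
  An embedding \<open>e\<close> in \<open>E\<close> is a word of length \<open>n + 1\<close> in the letters \<open>*\<close> (identity coordinate) and
  \<open>S = {a\<^sub>i, b\<^sub>i}\<close> (constant coordinate) with at least one \<open>*\<close>.  Since \<open>e\<close> is an isomorphism onto its
  image, the divisor of \<open>f\<^sub>e\<close> is the image of \<open>div f = 2 D\<close>, so that, with
  \<open>\<epsilon> = 1\<close> on the \<open>a\<^sub>i\<close> and \<open>\<epsilon> = - 1\<close> on the \<open>b\<^sub>i\<close>, the boundary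
  of \<open>e(C) \<otimes> f\<^sub>e\<close> is \<open>2 \<Sum>\<^sub>p \<epsilon>(p) [e(p)]\<close>: replace all stars of the word by one and the same
  letter and add up with signs.  The cycle condition on the coefficients \<open>m\<^sub>e\<close> is therefore a
  question about words (\<open>sum_embeddings_eq_word_boundary\<close>).

  A function on words that is invariant under permutations of the positions is a homogeneous polynomial
  of degree \<open>n + 1\<close> in a variable \<open>t\<close> for the star, \<open>x\<^sub>i\<close> for \<open>a\<^sub>i\<close> and \<open>y\<^sub>i\<close> for \<open>b\<^sub>i\<close>, divisible by
  \<open>t\<close>.  Let \<open>p\<^sub>k\<close> be the power sums in the \<open>x\<^sub>i\<close>, \<open>q\<^sub>k\<close> those in the \<open>y\<^sub>i\<close>, and \<open>d\<^sub>k = p\<^sub>k - q\<^sub>k\<close>.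
  Up to the factor 2 the boundary is the linear substitution \<open>t\<^sup>k \<mapsto> d\<^sub>k\<close>.  Wanted is a nonzero polynomial in
  its kernel that is symmetric in the \<open>x\<^sub>i\<close>, symmetric in the \<open>y\<^sub>i\<close> and unchanged under \<open>x \<leftrightarrow> y\<close>.

  For \<open>n \<ge> 3\<close> the Koszul relation between \<open>d\<^sub>1\<close> and \<open>d\<^sub>2\<close> provides one:
  \<open>(t d\<^sub>2 - t\<^sup>2 d\<^sub>1) d\<^sub>n\<^sub>-\<^sub>2\<close>.  Exchanging \<open>x\<close> and \<open>y\<close> changes the sign of every \<open>d\<^sub>k\<close>, and
  the last factor restores the invariance.  For \<open>n \<le> 2\<close> the degree leaves no room for that factor.
  There the number of points comes in: in \<open>n\<close> variables \<open>p\<^sub>n\<^sub>+\<^sub>1\<close> is a polynomial in the lower power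
  sums (Newton), and subtracting the same identity for the \<open>y\<^sub>i\<close> expresses \<open>d\<^sub>n\<^sub>+\<^sub>1\<close> through lower \<open>d\<^sub>k\<close>
  with invariant coefficients.  These cases are collected in \<open>exists_invariant_word_cycle\<close>.

  Two geometric facts carry the reduction.  Every word with a star is realized by a closed embedding
  (\<open>closed_embedding_coordinate_map\<close>), because two points of a projective variety lie in a common
  affine open set and are separated there by a regular function.  The order of a rational function is
  transported by isomorphisms (\<open>divisor_of_transport_rat\<close>).  Finally distinct embeddings have distinct
  images, so that nonzero coefficients give a nonzero formal sum, and \<open>E\<close> is finite, so that the
  space of cycles is finite-dimensional and its dimension is positive.
\<close>

section \<open>Cycles on words\<close>

text \<open>Words are functions into the option type: \<open>None\<close> is the star, \<open>Some s\<close> the constant letter \<open>s\<close>.\<close>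

definition starred :: "nat set \<Rightarrow> (nat \<Rightarrow> 'a) \<Rightarrow> nat \<Rightarrow> 'a option" where
  "starred J x j = (if j \<in> J then None else Some (x j))"

text \<open>
  The coefficient at \<open>x\<close> of the boundary.  The words that yield \<open>x\<close> when all their stars are replaced
  by \<open>p\<close> are the \<open>starred J x\<close> with \<open>x = p\<close> on the nonempty set \<open>J\<close>; the condition \<open>x ` J = {p}\<close>
  says both.
\<close>

definition word_boundary ::
  "'a set \<Rightarrow> ('a \<Rightarrow> rat) \<Rightarrow> nat \<Rightarrow> ((nat \<Rightarrow> 'a option) \<Rightarrow> rat) \<Rightarrow> (nat \<Rightarrow> 'a) \<Rightarrow> rat" where
  "word_boundary S \<epsilon> n \<mu> x =
     (\<Sum>J\<in>Pow {..n}. \<Sum>p\<in>S. if x ` J = {p} then \<epsilon> p * \<mu> (starred J x) else 0)"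

definition symmetrize :: "nat \<Rightarrow> ((nat \<Rightarrow> 'b) \<Rightarrow> rat) \<Rightarrow> (nat \<Rightarrow> 'b) \<Rightarrow> rat" where
  "symmetrize n T w = (\<Sum>\<sigma> | \<sigma> permutes {..n}. T (w \<circ> \<sigma>))"

text \<open>
  Extending the sign by 0 to the star makes terms vanish unless the letter they look at is a
  constant.
\<close>

definition word_sign :: "('a \<Rightarrow> rat) \<Rightarrow> 'a option \<Rightarrow> rat" where
  "word_sign \<epsilon> l = (case l of None \<Rightarrow> 0 | Some s \<Rightarrow> \<epsilon> s)"

lemma word_sign_simps [simp]: "word_sign \<epsilon> None = 0" "word_sign \<epsilon> (Some s) = \<epsilon> s"
  by (auto simp: word_sign_def)

text \<open>
  The tensors \<open>t \<otimes> d\<^sub>2 \<otimes> d\<^sub>n\<^sub>-\<^sub>2\<close> and \<open>t \<otimes> t \<otimes> d\<^sub>1 \<otimes> d\<^sub>n\<^sub>-\<^sub>2\<close>, where \<open>d\<^sub>k\<close> is the function on words of length \<open>k\<close>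
  that is \<open>\<epsilon> s\<close> on the constant word \<open>s\<dots>s\<close> and 0 on all other words.
\<close>

definition koszul1 :: "('a \<Rightarrow> rat) \<Rightarrow> nat \<Rightarrow> (nat \<Rightarrow> 'a option) \<Rightarrow> rat" where
  "koszul1 \<epsilon> n w =
     (if w 0 = None \<and> w 1 = w 2 \<and> (\<forall>j\<in>{3..n}. w j = w 3)
      then word_sign \<epsilon> (w 1) * word_sign \<epsilon> (w 3) else 0)"

definition koszul2 :: "('a \<Rightarrow> rat) \<Rightarrow> nat \<Rightarrow> (nat \<Rightarrow> 'a option) \<Rightarrow> rat" where
  "koszul2 \<epsilon> n w =
     (if w 0 = None \<and> w 1 = None \<and> (\<forall>j\<in>{3..n}. w j = w 3)
      then word_sign \<epsilon> (w 2) * word_sign \<epsilon> (w 3) else 0)"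

lemma symmetrize_permute:
  assumes "\<sigma> permutes {..n}"
  shows "symmetrize n T (w \<circ> \<sigma>) = symmetrize n T w"
  unfolding symmetrize_def
  by (rule sum.reindex_bij_witness[where i = "\<lambda>\<tau>. inv_into UNIV \<sigma> \<circ> \<tau>" and j = "\<lambda>\<tau>. \<sigma> \<circ> \<tau>"])
    (use assms in \<open>auto simp: comp_assoc[symmetric] permutes_inv_o permutes_compose permutes_inv\<close>)

text \<open>
  The boundary is equivariant: starring \<open>J\<close> and then permuting the positions is permuting them and then
  starring the preimage of \<open>J\<close>.
\<close>

lemma word_boundary_permute:
  assumes \<sigma>: "\<sigma> permutes {..n}"
  shows "word_boundary S \<epsilon> n (\<lambda>w. T (w \<circ> \<sigma>)) x = word_boundary S \<epsilon> n T (x \<circ> \<sigma>)"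
proof -
  have inj: "inj \<sigma>" using \<sigma> by (rule permutes_inj)
  have star: "starred (\<sigma> ` J) x \<circ> \<sigma> = starred J (x \<circ> \<sigma>)" for J
    using inj by (auto simp: starred_def fun_eq_iff inj_image_mem_iff)
  have "bij_betw ((`) \<sigma>) (Pow {..n}) (Pow {..n})"
    using permutes_imp_bij[OF \<sigma>] by (rule bij_betw_Pow)
  then show ?thesis
    unfolding word_boundary_def
    by (subst sum.reindex_bij_betw[symmetric, where h = "(`) \<sigma>"])
      (simp_all add: star image_comp del: o_apply cong: if_cong)
qed

lemma word_boundary_sum:
  "word_boundary S \<epsilon> n (\<lambda>w. \<Sum>i\<in>I. T i w) x = (\<Sum>i\<in>I. word_boundary S \<epsilon> n (T i) x)"
proof -
  have "(if P then (c::rat) * (\<Sum>i\<in>I. t i) else 0) = (\<Sum>i\<in>I. if P then c * t i else 0)" for P c t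
    by (simp add: sum_distrib_left)
  then show ?thesis
    unfolding word_boundary_def
    by (simp add: sum.swap[of _ S I] sum.swap[of _ "Pow {..n}" I])
qed

lemma word_boundary_diff:
  "word_boundary S \<epsilon> n (\<lambda>w. T w - U w) x = word_boundary S \<epsilon> n T x - word_boundary S \<epsilon> n U x"
proof -
  have "(if P then (c::rat) * (t - u) else 0) = (if P then c * t else 0) - (if P then c * u else 0)"
    for P c t u
    by (simp add: algebra_simps)
  then show ?thesis
    unfolding word_boundary_def by (simp add: sum_subtractf)
qed

lemma word_boundary_symmetrize:
  "word_boundary S \<epsilon> n (symmetrize n T) x = symmetrize n (word_boundary S \<epsilon> n T) x"
  unfolding symmetrize_def by (simp add: word_boundary_sum word_boundary_permute)

lemma word_boundary_single:
  assumes "finite S" "K \<subseteq> {..n}" "x ` K = {p}" "p \<in> S"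
    and "\<And>J. J \<subseteq> {..n} \<Longrightarrow> J \<noteq> K \<Longrightarrow> T (starred J x) = 0"
  shows "word_boundary S \<epsilon> n T x = \<epsilon> p * T (starred K x)"
proof -
  have "word_boundary S \<epsilon> n T x =
      (\<Sum>J\<in>Pow {..n}. if J = K then (\<Sum>p\<in>S. if x ` K = {p} then \<epsilon> p * T (starred K x) else 0) else 0)"
    unfolding word_boundary_def by (rule sum.cong) (simp_all add: assms(5) cong: if_cong)
  also have "\<dots> = \<epsilon> p * T (starred K x)"
    using assms(1-4) by simp
  finally show ?thesis .
qed

text \<open>
  A word in the support of \<open>koszul1\<close> has its star in position 0 only, so \<open>J = {0}\<close> is the only term:
  the boundary is \<open>d\<^sub>1 \<otimes> d\<^sub>2 \<otimes> d\<^sub>n\<^sub>-\<^sub>2\<close>.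
\<close>

lemma word_boundary_koszul1:
  assumes "n \<ge> 3" "finite S" "x ` {..n} \<subseteq> S"
  shows "word_boundary S \<epsilon> n (koszul1 \<epsilon> n) x =
    (if x 1 = x 2 \<and> (\<forall>j\<in>{3..n}. x j = x 3) then \<epsilon> (x 0) * \<epsilon> (x 1) * \<epsilon> (x 3) else 0)"
proof -
  have *: "koszul1 \<epsilon> n (starred J x) = 0" if J: "J \<subseteq> {..n}" "J \<noteq> {0}" for J
  proof (rule ccontr)
    assume nz: "koszul1 \<epsilon> n (starred J x) \<noteq> 0"
    have cond: "starred J x 0 = None" "starred J x 1 = starred J x 2" and eq: "\<And>j. j \<in> {3..n} \<Longrightarrow> starred J x j = starred J x 3"
      using nz unfolding koszul1_def by meson+
    have "word_sign \<epsilon> (starred J x 1) * word_sign \<epsilon> (starred J x 3) \<noteq> 0"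
      using nz unfolding koszul1_def by meson
    then have *: "0 \<in> J" "1 \<notin> J" "3 \<notin> J" "2 \<notin> J"
      using cond by (simp_all add: starred_def split: if_splits)
    have "j \<notin> J" if "j \<in> {3..n}" for j
      using eq[OF that] *(3) by (auto simp: starred_def split: if_splits)
    moreover have "j \<in> {3..n} \<or> j = 0 \<or> j = 1 \<or> j = 2" if "j \<in> J" for j
      using that J by auto
    ultimately have "J = {0}" using * by blast
    then show False using J by simp
  qed
  have "word_boundary S \<epsilon> n (koszul1 \<epsilon> n) x = \<epsilon> (x 0) * koszul1 \<epsilon> n (starred {0} x)"
    using assms by (intro word_boundary_single) (auto simp: *)
  moreover define P where "P \<longleftrightarrow> (\<forall>j\<in>{3..n}. x j = x 3)"
  moreover have "(\<forall>j\<in>{3..n}. starred {0} x j = starred {0} x 3) \<longleftrightarrow> P"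
    unfolding P_def by (intro ball_cong) (auto simp: starred_def)
  ultimately show ?thesis
    unfolding koszul1_def P_def[symmetric] by (simp add: starred_def)
qed

text \<open>
  Here the stars are exactly in the positions 0 and 1, and the boundary is
  \<open>d\<^sub>2 \<otimes> d\<^sub>1 \<otimes> d\<^sub>n\<^sub>-\<^sub>2\<close>.
\<close>

lemma word_boundary_koszul2:
  assumes "n \<ge> 3" "finite S" "x ` {..n} \<subseteq> S"
  shows "word_boundary S \<epsilon> n (koszul2 \<epsilon> n) x =
    (if x 0 = x 1 \<and> (\<forall>j\<in>{3..n}. x j = x 3) then \<epsilon> (x 0) * \<epsilon> (x 2) * \<epsilon> (x 3) else 0)"
proof -
  have *: "koszul2 \<epsilon> n (starred J x) = 0" if J: "J \<subseteq> {..n}" "J \<noteq> {0, 1}" for J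
  proof (rule ccontr)
    assume nz: "koszul2 \<epsilon> n (starred J x) \<noteq> 0"
    have cond: "starred J x 0 = None" "starred J x 1 = None" and eq: "\<And>j. j \<in> {3..n} \<Longrightarrow> starred J x j = starred J x 3"
      using nz unfolding koszul2_def by meson+
    have "word_sign \<epsilon> (starred J x 2) * word_sign \<epsilon> (starred J x 3) \<noteq> 0"
      using nz unfolding koszul2_def by meson
    then have *: "0 \<in> J" "1 \<in> J" "3 \<notin> J" "2 \<notin> J"
      using cond by (simp_all add: starred_def split: if_splits)
    have "j \<notin> J" if "j \<in> {3..n}" for j
      using eq[OF that] *(3) by (auto simp: starred_def split: if_splits)
    moreover have "j \<in> {3..n} \<or> j = 0 \<or> j = 1 \<or> j = 2" if "j \<in> J" for j
      using that J by auto
    ultimately have "J = {0, 1}" using * by blast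
    then show False using J by simp
  qed
  show ?thesis
  proof (cases "x 0 = x 1")
    case True
    then have "word_boundary S \<epsilon> n (koszul2 \<epsilon> n) x = \<epsilon> (x 0) * koszul2 \<epsilon> n (starred {0, 1} x)"
      using assms by (intro word_boundary_single) (auto simp: *)
    moreover define P where "P \<longleftrightarrow> (\<forall>j\<in>{3..n}. x j = x 3)"
    moreover have "(\<forall>j\<in>{3..n}. starred {0, 1} x j = starred {0, 1} x 3) \<longleftrightarrow> P"
      unfolding P_def by (intro ball_cong) (auto simp: starred_def)
    ultimately show ?thesis
      using True unfolding koszul2_def P_def[symmetric] by (simp add: starred_def)
  next
    case False
    have "(if x ` J = {p} then \<epsilon> p * koszul2 \<epsilon> n (starred J x) else 0) = 0" if "J \<subseteq> {..n}" for J p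
      using False *[OF that] by (cases "J = {0, 1}") auto
    then have "word_boundary S \<epsilon> n (koszul2 \<epsilon> n) x = 0"
      unfolding word_boundary_def by (intro sum.neutral ballI) auto
    then show ?thesis using False by simp
  qed
qed

text \<open>
  The boundaries \<open>d\<^sub>1 \<otimes> d\<^sub>2 \<otimes> d\<^sub>n\<^sub>-\<^sub>2\<close> and \<open>d\<^sub>2 \<otimes> d\<^sub>1 \<otimes> d\<^sub>n\<^sub>-\<^sub>2\<close> of the two tensors differ by a cyclic
  permutation of the first three positions, so they agree after symmetrization.
\<close>

lemma word_boundary_koszul:
  assumes "n \<ge> 3" "finite S" "x ` {..n} \<subseteq> S"
  shows "word_boundary S \<epsilon> n (symmetrize n (\<lambda>w. koszul1 \<epsilon> n w - koszul2 \<epsilon> n w)) x = 0"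
proof -
  \<comment> \<open>The cyclic permutation that moves the factor \<open>d\<^sub>1\<close> past the factor \<open>d\<^sub>2\<close>.\<close>
  define \<rho> :: "nat \<Rightarrow> nat" where
    "\<rho> = (\<lambda>j. if j = 0 then 1 else if j = 1 then 2 else if j = 2 then 0 else j)"
  have \<rho>: "\<rho> permutes {..n}"
  proof (rule bij_imp_permutes)
    show "bij_betw \<rho> {..n} {..n}"
      using assms(1)
      by (intro bij_betwI[where g = "\<lambda>j. if j = 0 then 2 else if j = 1 then 0 else if j = 2 then 1 else j"])
        (auto simp: \<rho>_def)
    show "\<And>j. j \<notin> {..n} \<Longrightarrow> \<rho> j = j"
      using assms(1) by (auto simp: \<rho>_def)
  qed
  have S: "(x \<circ> \<sigma>) ` {..n} \<subseteq> S" if "\<sigma> permutes {..n}" for \<sigma>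
    using assms(3) permutes_image[OF that] by (metis image_comp)
  have rot: "word_boundary S \<epsilon> n (koszul2 \<epsilon> n) (x \<circ> \<sigma> \<circ> \<rho>) = word_boundary S \<epsilon> n (koszul1 \<epsilon> n) (x \<circ> \<sigma>)"
    if \<sigma>: "\<sigma> permutes {..n}" for \<sigma>
  proof -
    have S': "(x \<circ> \<sigma> \<circ> \<rho>) ` {..n} \<subseteq> S"
      using S[OF permutes_compose[OF \<rho> \<sigma>]] by (simp add: comp_assoc)
    have "(\<forall>j\<in>{3..n}. (x \<circ> \<sigma> \<circ> \<rho>) j = (x \<circ> \<sigma> \<circ> \<rho>) 3) \<longleftrightarrow> (\<forall>j\<in>{3..n}. (x \<circ> \<sigma>) j = (x \<circ> \<sigma>) 3)"
      by (rule ball_cong) (auto simp: \<rho>_def)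
    moreover have "\<rho> 0 = 1" "\<rho> 1 = 2" "\<rho> 2 = 0" "\<rho> 3 = 3"
      by (simp_all add: \<rho>_def)
    ultimately show ?thesis
      unfolding word_boundary_koszul1[OF assms(1,2) S[OF \<sigma>]] word_boundary_koszul2[OF assms(1,2) S']
      by (simp only: o_apply) (simp only: mult_ac)
  qed
  have "symmetrize n (word_boundary S \<epsilon> n (koszul2 \<epsilon> n)) x
      = (\<Sum>\<sigma> | \<sigma> permutes {..n}. word_boundary S \<epsilon> n (koszul2 \<epsilon> n) (x \<circ> (\<sigma> \<circ> \<rho>)))"
    unfolding symmetrize_def by (rule sum_permutations_compose_right[OF \<rho>])
  also have "\<dots> = symmetrize n (word_boundary S \<epsilon> n (koszul1 \<epsilon> n)) x"
    unfolding symmetrize_def by (rule sum.cong) (simp_all add: rot flip: comp_assoc)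
  finally show ?thesis
    unfolding word_boundary_symmetrize word_boundary_diff
    by (simp add: symmetrize_def sum_subtractf)
qed

definition star_count :: "nat \<Rightarrow> (nat \<Rightarrow> 'a option) \<Rightarrow> nat" where
  "star_count n w = (\<Sum>j\<le>n. if w j = None then 1 else 0)"

text \<open>
  For one pair of points: the polynomial \<open>- 2 (t\<^sup>2 - t (x + y))\<close>, in the kernel because
  \<open>x\<^sup>2 - y\<^sup>2 = (x + y) (x - y)\<close>.  A word gets the coefficient of its monomial divided by the number of
  words with that monomial.
\<close>

definition newton1 :: "(nat \<Rightarrow> 'a option) \<Rightarrow> rat" where
  "newton1 w = (if star_count 1 w = 2 then - 2 else 1)"

text \<open>
  For two pairs of points: three times the polynomial
  \<open>4 t\<^sup>3 - 3 t\<^sup>2 (p\<^sub>1 + q\<^sub>1) + t (2 (p\<^sub>1\<^sup>2 + p\<^sub>1 q\<^sub>1 + q\<^sub>1\<^sup>2) - 3 (p\<^sub>2 + q\<^sub>2))\<close>, which comes from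
  \<open>2 p\<^sub>3 = 3 p\<^sub>1 p\<^sub>2 - p\<^sub>1\<^sup>3\<close> in two variables.  On words with one star the last two cases distinguish
  two different letters of the same sign from two letters of opposite sign.
\<close>

definition newton2 :: "('a \<Rightarrow> rat) \<Rightarrow> (nat \<Rightarrow> 'a option) \<Rightarrow> rat" where
  "newton2 \<epsilon> w =
     (if star_count 2 w = 3 then 12
      else if star_count 2 w = 2 then - 3
      else if card (w ` {..2} - {None}) = 1 then - 1
      else if card (word_sign \<epsilon> ` (w ` {..2} - {None})) = 1 then 2
      else 1)"

lemma star_count_permute:
  assumes "\<sigma> permutes {..n}"
  shows "star_count n (w \<circ> \<sigma>) = star_count n w"
  using sum.permute[OF assms, of "\<lambda>j. if w j = None then 1 else 0 :: nat"]
  by (simp add: star_count_def o_def)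

lemma sum_Pow_insert:
  assumes "finite A" "a \<notin> A"
  shows "sum g (Pow (insert a A)) = sum g (Pow A) + (\<Sum>J\<in>Pow A. g (insert a J) :: rat)"
proof -
  have "inj_on (insert a) (Pow A)"
    using assms(2) by (auto simp: inj_on_def insert_ident)
  moreover have "Pow A \<inter> insert a ` Pow A = {}"
    using assms(2) by auto
  ultimately show ?thesis
    using assms(1) by (simp add: Pow_insert sum.union_disjoint sum.reindex)
qed

lemma atMost_1_2: "{..1::nat} = {0, 1}" "{..2::nat} = {0, 1, 2}"
  by auto


text \<open>
  At most one \<open>p\<close> contributes to the inner sum of \<open>word_boundary\<close>, and any element of the set tells
  which.
\<close>

lemma sum_singleton_image:
  assumes "finite S" "u \<in> S" "u \<in> A"
  shows "(\<Sum>p\<in>S. if A = {p} then g p else (0::rat)) = (if A = {u} then g u else 0)"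
proof -
  have "(\<Sum>p\<in>S. if A = {p} then g p else 0) = (\<Sum>p\<in>S. if p = u then (if A = {u} then g u else 0) else 0)"
    by (rule sum.cong) (use assms in auto)
  then show ?thesis using assms by simp
qed

lemma word_boundary_singleton_sums:
  assumes "finite S" "x ` {..n} \<subseteq> S"
  shows "word_boundary S \<epsilon> n \<mu> x = (\<Sum>J\<in>Pow {..n}. if J = {} then 0 else
     if x ` J = {x (Min J)} then \<epsilon> (x (Min J)) * \<mu> (starred J x) else 0)"
  unfolding word_boundary_def
proof (rule sum.cong)
  fix J assume J: "J \<in> Pow {..n}"
  show "(\<Sum>p\<in>S. if x ` J = {p} then \<epsilon> p * \<mu> (starred J x) else 0) = (if J = {} then 0 else
     if x ` J = {x (Min J)} then \<epsilon> (x (Min J)) * \<mu> (starred J x) else 0)"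
  proof (cases "J = {}")
    case False
    then have "Min J \<in> J" using J finite_subset by (auto intro!: Min_in)
    then show ?thesis
      using assms J False by (subst sum_singleton_image[where u = "x (Min J)"]) auto
  qed simp
qed simp

text \<open>
  With one letter of each sign, two different letters have opposite signs; then the words with a single
  star cancel, and at a constant \<open>x\<close> the three terms are \<open>1 + 1 - 2\<close> times the sign.
\<close>

lemma word_boundary_newton1:
  assumes "finite S" "x ` {..1} \<subseteq> S"
    and opp: "\<And>s t. s \<in> S \<Longrightarrow> t \<in> S \<Longrightarrow> s \<noteq> t \<Longrightarrow> \<epsilon> t = - \<epsilon> s"
  shows "word_boundary S \<epsilon> 1 newton1 x = 0"
proof -
  have S: "x 0 \<in> S" "x 1 \<in> S" using assms(2) by auto
  have "star_count 1 (starred {0} x) = 1" "star_count 1 (starred {1} x) = 1" "star_count 1 (starred {0, 1} x) = 2"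
    by (auto simp: star_count_def starred_def atMost_1_2)
  then have "word_boundary S \<epsilon> 1 newton1 x = \<epsilon> (x 0) + \<epsilon> (x 1) - (if x 0 = x 1 then 2 * \<epsilon> (x 0) else 0)"
    unfolding word_boundary_singleton_sums[OF assms(1,2)] atMost_1_2
    by (auto simp: sum_Pow_insert newton1_def)
  then show ?thesis
    using opp[OF S] by auto
qed

text \<open>
  The hypothesis \<open>opp\<close> holds when there are at most two letters of each sign.  It excludes the points
  with three different coordinates of one sign, where the boundary would be 6 times that sign.
\<close>

lemma word_boundary_newton2:
  assumes "finite S" "x ` {..2} \<subseteq> S" and sgn: "\<And>s. s \<in> S \<Longrightarrow> \<epsilon> s = 1 \<or> \<epsilon> s = - 1"
    and opp: "\<And>s t u. s \<in> S \<Longrightarrow> t \<in> S \<Longrightarrow> u \<in> S \<Longrightarrow> s \<noteq> t \<Longrightarrow> s \<noteq> u \<Longrightarrow> t \<noteq> u \<Longrightarrow> \<not> (\<epsilon> s = \<epsilon> t \<and> \<epsilon> t = \<epsilon> u)"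
  shows "word_boundary S \<epsilon> 2 (newton2 \<epsilon>) x = 0"
proof -
  have S: "x 0 \<in> S" "x 1 \<in> S" "x 2 \<in> S" using assms(2) by auto
  define pair where "pair s t = (if s = t then - 1 else if \<epsilon> s = \<epsilon> t then 2 else (1::rat))" for s t
  have pair: "newton2 \<epsilon> (starred J x) = pair s t"
    if "star_count 2 (starred J x) = 1" "starred J x ` {..2} - {None} = {Some s, Some t}" for J s t
    unfolding newton2_def that by (simp add: pair_def card_insert_if)
  have count: "star_count 2 (starred J x) = of_bool (0 \<in> J) + of_bool (1 \<in> J) + of_bool (2 \<in> J)" for J
    by (simp add: star_count_def starred_def atMost_1_2)
  have "newton2 \<epsilon> (starred {0} x) = pair (x 1) (x 2)" "newton2 \<epsilon> (starred {1} x) = pair (x 0) (x 2)"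
    "newton2 \<epsilon> (starred {2} x) = pair (x 0) (x 1)"
    by (rule pair; force simp: count starred_def atMost_1_2)+
  moreover have "newton2 \<epsilon> (starred {0, 1} x) = - 3" "newton2 \<epsilon> (starred {0, 2} x) = - 3"
    "newton2 \<epsilon> (starred {1, 2} x) = - 3" "newton2 \<epsilon> (starred {0, 1, 2} x) = 12"
    by (simp_all add: newton2_def count)
  moreover have img: "x ` {0, 1} = {x 0} \<longleftrightarrow> x 0 = x 1" "x ` {0, 2} = {x 0} \<longleftrightarrow> x 0 = x 2"
    "x ` {1, 2} = {x 1} \<longleftrightarrow> x 1 = x 2" "x ` {0, 1, 2} = {x 0} \<longleftrightarrow> x 0 = x 1 \<and> x 1 = x 2"
    by auto
  ultimately have "word_boundary S \<epsilon> 2 (newton2 \<epsilon>) x = \<epsilon> (x 0) * pair (x 1) (x 2) + \<epsilon> (x 1) * pair (x 0) (x 2)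
    + \<epsilon> (x 2) * pair (x 0) (x 1) - (if x 0 = x 1 then 3 * \<epsilon> (x 0) else 0) - (if x 0 = x 2 then 3 * \<epsilon> (x 0) else 0)
    - (if x 1 = x 2 then 3 * \<epsilon> (x 1) else 0) + (if x 0 = x 1 \<and> x 1 = x 2 then 12 * \<epsilon> (x 0) else 0)"
    unfolding word_boundary_singleton_sums[OF assms(1,2)] atMost_1_2
    by (simp add: sum_Pow_insert img)
  note eq = this
  note sgns = sgn[OF S(1)] sgn[OF S(2)] sgn[OF S(3)]
  consider "x 0 = x 1" "x 1 = x 2" | "x 0 = x 1" "x 1 \<noteq> x 2" | "x 0 = x 2" "x 0 \<noteq> x 1"
    | "x 1 = x 2" "x 0 \<noteq> x 1" | "x 0 \<noteq> x 1" "x 0 \<noteq> x 2" "x 1 \<noteq> x 2"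
    by metis
  then show ?thesis
  proof cases
    case 5
    then show ?thesis
      using opp[OF S] sgns unfolding eq by (elim disjE) (simp_all add: pair_def)
  qed (use sgns in \<open>unfold eq, auto simp: pair_def\<close>)
qed

lemma card_Collect_le_1:
  assumes "finite S" "card {s\<in>S. P s} \<le> 1" "s \<in> S" "t \<in> S" "P s" "P t"
  shows "s = t"
  using card_mono[of "{s\<in>S. P s}" "{s, t}"] assms by (cases "s = t") auto

text \<open>
  What is needed of a coefficient function on words.  The third clause covers all relabelings at once:
  permutations of the \<open>a\<^sub>i\<close> or of the \<open>b\<^sub>i\<close> preserve the signs (\<open>\<kappa> = 1\<close>), and switching the two families
  reverses them (\<open>\<kappa> = - 1\<close>).
\<close>

definition invariant_word_cycle ::
  "'a set \<Rightarrow> ('a \<Rightarrow> rat) \<Rightarrow> nat \<Rightarrow> ((nat \<Rightarrow> 'a option) \<Rightarrow> rat) \<Rightarrow> bool" where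
  "invariant_word_cycle S \<epsilon> n \<mu> \<longleftrightarrow>
     (\<forall>w w'. (\<forall>j\<le>n. w j = w' j) \<longrightarrow> \<mu> w = \<mu> w') \<and>
     (\<forall>\<sigma> w. \<sigma> permutes {..n} \<longrightarrow> \<mu> (w \<circ> \<sigma>) = \<mu> w) \<and>
     (\<forall>\<tau> \<kappa> w. \<kappa> \<in> {1, - 1} \<and> inj_on \<tau> S \<and> (\<forall>s\<in>S. \<epsilon> (\<tau> s) = \<kappa> * \<epsilon> s) \<and>
        w ` {..n} \<subseteq> insert None (Some ` S) \<longrightarrow> \<mu> (map_option \<tau> \<circ> w) = \<mu> w) \<and>
     (\<forall>x. x ` {..n} \<subseteq> S \<longrightarrow> word_boundary S \<epsilon> n \<mu> x = 0)"

text \<open>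
  For \<open>n \<le> 2\<close> the word of stars has a nonzero coefficient.  For \<open>n \<ge> 3\<close> that coefficient is 0, and the
  word \<open>**s\<dots>s\<close> serves instead: only the term \<open>- t\<^sup>2 d\<^sub>1 d\<^sub>n\<^sub>-\<^sub>2\<close> contributes to it, and all its
  contributions have the same sign.
\<close>

lemma exists_invariant_word_cycle:
  assumes n: "n > 0" and fin: "finite S" and ne: "S \<noteq> {}"
    and sgn: "\<And>s. s \<in> S \<Longrightarrow> \<epsilon> s = 1 \<or> \<epsilon> s = (- 1 :: rat)"
    and few: "card {s\<in>S. \<epsilon> s = 1} \<le> n" "card {s\<in>S. \<epsilon> s = - 1} \<le> n"
  shows "\<exists>\<mu>. invariant_word_cycle S \<epsilon> n \<mu> \<and>
    (\<exists>w. w ` {..n} \<subseteq> insert None (Some ` S) \<and> None \<in> w ` {..n} \<and> \<mu> w \<noteq> 0)"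
proof -
  have that: ?thesis
    if "\<And>w w'. \<forall>j\<le>n. w j = w' j \<Longrightarrow> \<mu> w = \<mu> w'"
      and "\<And>\<sigma> w. \<sigma> permutes {..n} \<Longrightarrow> \<mu> (w \<circ> \<sigma>) = \<mu> w"
      and "\<And>\<tau> \<kappa> w. \<kappa> = 1 \<or> \<kappa> = - 1 \<Longrightarrow> inj_on \<tau> S \<Longrightarrow> (\<And>s. s \<in> S \<Longrightarrow> \<epsilon> (\<tau> s) = \<kappa> * \<epsilon> s) \<Longrightarrow>
        w ` {..n} \<subseteq> insert None (Some ` S) \<Longrightarrow> \<mu> (map_option \<tau> \<circ> w) = \<mu> w"
      and "\<And>x. x ` {..n} \<subseteq> S \<Longrightarrow> word_boundary S \<epsilon> n \<mu> x = 0"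
      and "\<exists>w. w ` {..n} \<subseteq> insert None (Some ` S) \<and> None \<in> w ` {..n} \<and> \<mu> w \<noteq> 0" for \<mu>
  proof -
    have "invariant_word_cycle S \<epsilon> n \<mu>"
      unfolding invariant_word_cycle_def
      by (intro conjI allI impI; (erule that(2) | erule that(4) | (rule that(3); auto) | erule that(1)))
    then show ?thesis using that(5) by blast
  qed
  define L where "L = insert None (Some ` S)"
  have inj: "inj_on (map_option \<tau>) L" if "inj_on \<tau> S" for \<tau> :: "'a \<Rightarrow> 'a"
    using that by (auto simp: L_def inj_on_def)
  have sign: "word_sign \<epsilon> (map_option \<tau> l) = \<kappa> * word_sign \<epsilon> l"
    if "\<And>s. s \<in> S \<Longrightarrow> \<epsilon> (\<tau> s) = \<kappa> * \<epsilon> s" "l \<in> L" for \<tau> \<kappa> l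
    using that by (auto simp: L_def)
  consider "n = 1" | "n = 2" | "n \<ge> 3" using n by linarith
  then show ?thesis
  proof cases
    case 1
    have opp: "\<epsilon> t = - \<epsilon> s" if "s \<in> S" "t \<in> S" "s \<noteq> t" for s t
      using card_Collect_le_1[OF fin, of "\<lambda>s. \<epsilon> s = 1" s t] card_Collect_le_1[OF fin, of "\<lambda>s. \<epsilon> s = -1" s t]
        few that sgn[of s] sgn[of t] 1 by auto
    show ?thesis
    proof (rule that[of newton1])
      show "newton1 w = newton1 w'" if "\<forall>j\<le>n. w j = w' j" for w w' :: "nat \<Rightarrow> 'a option"
        using that 1 by (auto simp: newton1_def star_count_def)
      show "newton1 (w \<circ> \<sigma>) = newton1 w" if "\<sigma> permutes {..n}" for \<sigma> and w :: "nat \<Rightarrow> 'a option"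
        using that 1 by (simp add: newton1_def star_count_permute)
      show "newton1 (map_option \<tau> \<circ> w) = newton1 w" for \<tau> :: "'a \<Rightarrow> 'a" and w
        by (simp add: newton1_def star_count_def)
      show "word_boundary S \<epsilon> n newton1 x = 0" if "x ` {..n} \<subseteq> S" for x
        using word_boundary_newton1[OF fin _ opp] that 1 by simp
      show "\<exists>w. w ` {..n} \<subseteq> insert None (Some ` S) \<and> None \<in> w ` {..n} \<and> newton1 w \<noteq> 0"
        by (rule exI[of _ "\<lambda>_. None"]) (auto simp: newton1_def)
    qed
  next
    case 2
    have opp: "\<not> (\<epsilon> s = \<epsilon> t \<and> \<epsilon> t = \<epsilon> u)"
      if "s \<in> S" "t \<in> S" "u \<in> S" "s \<noteq> t" "s \<noteq> u" "t \<noteq> u" for s t u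
    proof
      assume eq: "\<epsilon> s = \<epsilon> t \<and> \<epsilon> t = \<epsilon> u"
      have "card {s, t, u} \<le> card {v\<in>S. \<epsilon> v = \<epsilon> s}"
        using that eq fin by (intro card_mono) auto
      moreover have "card {s, t, u} = 3" using that by simp
      ultimately show False
        using few 2 sgn[OF that(1)] by auto
    qed
    show ?thesis
    proof (rule that[of "newton2 \<epsilon>"])
      show "newton2 \<epsilon> w = newton2 \<epsilon> w'" if "\<forall>j\<le>n. w j = w' j" for w w'
      proof -
        have "w ` {..2} = w' ` {..2}" "star_count 2 w = star_count 2 w'"
          using that 2 by (auto simp: star_count_def intro!: image_cong)
        then show ?thesis by (simp add: newton2_def)
      qed
      show "newton2 \<epsilon> (w \<circ> \<sigma>) = newton2 \<epsilon> w" if "\<sigma> permutes {..n}" for \<sigma> w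
      proof -
        have "(w \<circ> \<sigma>) ` {..2} = w ` {..2}" "star_count 2 (w \<circ> \<sigma>) = star_count 2 w"
          using permutes_image[OF that] that 2 by (simp_all only: star_count_permute flip: image_comp)
        then show ?thesis unfolding newton2_def by (simp only:)
      qed
      show "newton2 \<epsilon> (map_option \<tau> \<circ> w) = newton2 \<epsilon> w"
        if \<kappa>: "\<kappa> = 1 \<or> \<kappa> = - 1" and \<tau>: "inj_on \<tau> S" "\<And>s. s \<in> S \<Longrightarrow> \<epsilon> (\<tau> s) = \<kappa> * \<epsilon> s"
          and w: "w ` {..n} \<subseteq> insert None (Some ` S)" for \<tau> \<kappa> w
      proof -
        define A where "A = w ` {..2} - {None}"
        have A: "(map_option \<tau> \<circ> w) ` {..2} - {None} = map_option \<tau> ` A" "A \<subseteq> L"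
          using w 2 by (auto simp: A_def L_def)
        have "card (map_option \<tau> ` A) = card A"
          by (rule card_image[OF inj_on_subset[OF inj[OF \<tau>(1)] A(2)]])
        moreover have "word_sign \<epsilon> ` map_option \<tau> ` A = (*) \<kappa> ` word_sign \<epsilon> ` A"
          using sign[OF \<tau>(2)] A(2) by (force simp: image_image)
        then have "card (word_sign \<epsilon> ` map_option \<tau> ` A) = card (word_sign \<epsilon> ` A)"
          using \<kappa> by (auto intro!: card_image inj_onI)
        moreover have "star_count 2 (map_option \<tau> \<circ> w) = star_count 2 w"
          by (simp add: star_count_def)
        ultimately show ?thesis
          unfolding newton2_def A(1) A_def[symmetric] by (simp only:)
      qed
      show "word_boundary S \<epsilon> n (newton2 \<epsilon>) x = 0" if "x ` {..n} \<subseteq> S" for x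
        using word_boundary_newton2[OF fin _ sgn opp] that 2 by simp
      show "\<exists>w. w ` {..n} \<subseteq> insert None (Some ` S) \<and> None \<in> w ` {..n} \<and> newton2 \<epsilon> w \<noteq> 0"
        by (rule exI[of _ "\<lambda>_. None"]) (auto simp: newton2_def star_count_def)
    qed
  next
    case 3
    define T where "T = (\<lambda>w. koszul1 \<epsilon> n w - koszul2 \<epsilon> n w)"
    show ?thesis
    proof (rule that[of "symmetrize n T"])
      show "symmetrize n T w = symmetrize n T w'" if "\<forall>j\<le>n. w j = w' j" for w w'
      proof -
        have "T (w \<circ> \<sigma>) = T (w' \<circ> \<sigma>)" if "\<sigma> permutes {..n}" for \<sigma>
        proof -
          have eq: "(w \<circ> \<sigma>) j = (w' \<circ> \<sigma>) j" if "j \<le> n" for j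
            using permutes_in_image[OF \<open>\<sigma> permutes {..n}\<close>, of j] that \<open>\<forall>j\<le>n. w j = w' j\<close> by simp
          have "(w \<circ> \<sigma>) 0 = (w' \<circ> \<sigma>) 0" "(w \<circ> \<sigma>) 1 = (w' \<circ> \<sigma>) 1" "(w \<circ> \<sigma>) 2 = (w' \<circ> \<sigma>) 2"
            "(w \<circ> \<sigma>) 3 = (w' \<circ> \<sigma>) 3"
            "(\<forall>j\<in>{3..n}. (w \<circ> \<sigma>) j = (w \<circ> \<sigma>) 3) \<longleftrightarrow> (\<forall>j\<in>{3..n}. (w' \<circ> \<sigma>) j = (w' \<circ> \<sigma>) 3)"
            using eq 3 by (auto intro!: ball_cong)
          then show ?thesis unfolding T_def koszul1_def koszul2_def by (simp only:)
        qed
        then show ?thesis by (simp add: symmetrize_def)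
      qed
      show "symmetrize n T (w \<circ> \<sigma>) = symmetrize n T w" if "\<sigma> permutes {..n}" for \<sigma> w
        using that by (rule symmetrize_permute)
      show "symmetrize n T (map_option \<tau> \<circ> w) = symmetrize n T w"
        if \<kappa>: "\<kappa> = 1 \<or> \<kappa> = - 1" and \<tau>: "inj_on \<tau> S" "\<And>s. s \<in> S \<Longrightarrow> \<epsilon> (\<tau> s) = \<kappa> * \<epsilon> s"
          and w: "w ` {..n} \<subseteq> insert None (Some ` S)" for \<tau> \<kappa> w
      proof -
        have "T (map_option \<tau> \<circ> w \<circ> \<sigma>) = T (w \<circ> \<sigma>)" if "\<sigma> permutes {..n}" for \<sigma>
        proof -
          define v where "v = w \<circ> \<sigma>"
          have v: "v j \<in> L" if "j \<le> n" for j
            using permutes_in_image[OF \<open>\<sigma> permutes {..n}\<close>, of j] that w by (auto simp: v_def L_def)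
          have eq: "map_option \<tau> (v i) = map_option \<tau> (v j) \<longleftrightarrow> v i = v j" if "i \<le> n" "j \<le> n" for i j
            using inj_on_eq_iff[OF inj[OF \<tau>(1)] v[OF that(1)] v[OF that(2)]] .
          have sg: "word_sign \<epsilon> (map_option \<tau> (v j)) = \<kappa> * word_sign \<epsilon> (v j)" if "j \<le> n" for j
            using sign[OF \<tau>(2) v[OF that]] .
          have all: "(\<forall>j\<in>{3..n}. map_option \<tau> (v j) = map_option \<tau> (v 3)) \<longleftrightarrow> (\<forall>j\<in>{3..n}. v j = v 3)"
            using eq 3 by (intro ball_cong) auto
          have sq: "\<kappa> * a * (\<kappa> * b) = a * b" for a b using \<kappa> by auto
          have "1 \<le> n" "2 \<le> n" using 3 by auto
          then have "T (map_option \<tau> \<circ> v) = T v"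
            unfolding T_def koszul1_def koszul2_def o_apply all
            by (simp only: sg eq sq 3 option.map_disc_iff)
          then show ?thesis by (simp add: v_def comp_assoc)
        qed
        then show ?thesis by (simp add: symmetrize_def)
      qed
      show "word_boundary S \<epsilon> n (symmetrize n T) x = 0" if "x ` {..n} \<subseteq> S" for x
        unfolding T_def using 3 fin that by (rule word_boundary_koszul)
      obtain s where s: "s \<in> S" using ne by auto
      then have sq: "\<epsilon> s * \<epsilon> s = 1" using sgn by fastforce
      \<comment> \<open>The word \<open>**s\<dots>s\<close>.  It has two stars, so \<open>koszul1\<close> vanishes on all its permutations, and every
        nonzero value of \<open>koszul2\<close> on them is \<open>\<epsilon> s * \<epsilon> s = 1\<close>.\<close>
      define w where "w j = (if j \<le> 1 then None else Some s)" for j :: nat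
      have nonpos: "T (w \<circ> \<sigma>) \<le> 0" if "\<sigma> permutes {..n}" for \<sigma>
      proof -
        have "koszul1 \<epsilon> n (w \<circ> \<sigma>) = 0"
        proof (rule ccontr)
          assume nz: "koszul1 \<epsilon> n (w \<circ> \<sigma>) \<noteq> 0"
          then have "word_sign \<epsilon> (w (\<sigma> 1)) * word_sign \<epsilon> (w (\<sigma> 3)) \<noteq> 0" and
             c: "w (\<sigma> 1) = w (\<sigma> 2)" "\<forall>j\<in>{3..n}. w (\<sigma> j) = w (\<sigma> 3)"
            unfolding koszul1_def o_apply by meson+
          then have "w (\<sigma> 1) \<noteq> None" "w (\<sigma> 3) \<noteq> None"
            by (metis mult_eq_0_iff word_sign_simps(1))+
          then have *: "w (\<sigma> j) \<noteq> None" if "j \<le> n" "j \<noteq> 0" for j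
          proof -
            have "j = 1 \<or> j = 2 \<or> j \<in> {3..n}" using that by auto
            then show ?thesis using c \<open>w (\<sigma> 1) \<noteq> None\<close> \<open>w (\<sigma> 3) \<noteq> None\<close> by metis
          qed
          have "0 \<in> \<sigma> ` {..n}" "1 \<in> \<sigma> ` {..n}" using permutes_image[OF that] 3 by auto
          then obtain i j where ij: "i \<le> n" "j \<le> n" "\<sigma> i = 0" "\<sigma> j = 1" by (metis atMost_iff imageE)
          then have "w (\<sigma> i) = None" "w (\<sigma> j) = None" by (auto simp: w_def)
          then have "i = 0" "j = 0" using *[OF ij(1)] *[OF ij(2)] by blast+
          then show False using ij by simp
        qed
        moreover have "word_sign \<epsilon> (w i) * word_sign \<epsilon> (w j) \<ge> 0" for i j
          using sq by (simp add: w_def)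
        then have "koszul2 \<epsilon> n (w \<circ> \<sigma>) \<ge> 0" by (simp add: koszul2_def)
        ultimately show ?thesis by (simp add: T_def)
      qed
      have "symmetrize n T w = T (w \<circ> id) + (\<Sum>\<sigma>\<in>{\<sigma>. \<sigma> permutes {..n}} - {id}. T (w \<circ> \<sigma>))"
        unfolding symmetrize_def by (rule sum.remove) (auto intro: finite_permutations permutes_id)
      moreover have "(\<Sum>\<sigma>\<in>{\<sigma>. \<sigma> permutes {..n}} - {id}. T (w \<circ> \<sigma>)) \<le> 0"
        by (rule sum_nonpos) (auto intro: nonpos)
      moreover have "T (w \<circ> id) = - 1"
        using sq by (auto simp: T_def koszul1_def koszul2_def w_def)
      ultimately have "symmetrize n T w \<noteq> 0" by linarith
      moreover have "w ` {..n} \<subseteq> insert None (Some ` S)" "None \<in> w ` {..n}"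
        using s by (auto simp: w_def image_iff intro!: bexI[of _ 0])
      ultimately show "\<exists>w. w ` {..n} \<subseteq> insert None (Some ` S) \<and> None \<in> w ` {..n} \<and> symmetrize n T w \<noteq> 0"
        by blast
    qed
  qed
qed

section \<open>Regular functions on projective varieties\<close>

lemma topspace_proj_zariski: "topspace proj_zariski = UNIV"
proof -
  have "UNIV \<in> {{p::'a proj. \<forall>v\<in>hom_coords p. F v \<noteq> 0} | d F. form d F}"
    by (intro CollectI exI[of _ 0] exI[of _ "\<lambda>v. 1"]) (auto intro: form.const)
  then show ?thesis
    unfolding proj_zariski_def topology_generated_by_topspace by blast
qed

lemma openin_form_nonzero:
  "form d F \<Longrightarrow> openin proj_zariski {p. \<forall>v\<in>hom_coords p. F v \<noteq> 0}"
  unfolding proj_zariski_def by (rule topology_generated_by_Basis) blast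

lemma form_scale: "form d F \<Longrightarrow> F (c *s v) = c ^ d * F v"
  by (induction rule: form.induct) (auto simp: algebra_simps power_add)

lemma hom_coords_nonempty: "\<exists>v. v \<in> hom_coords p"
proof (rule ccontr)
  assume "\<nexists>v. v \<in> hom_coords p"
  then have "Rep_proj p \<subseteq> {0}" by (auto simp: hom_coords_def)
  then have "vec.dim (Rep_proj p) = 0" by (simp only: vec.dim_eq_0)
  then show False using Rep_proj[of p] by (simp del: vec.dim_eq_0)
qed

lemma Rep_proj_eq_span:
  assumes "v \<in> hom_coords p"
  shows "Rep_proj p = vec.span {v}"
proof -
  have p: "vec.subspace (Rep_proj p)" "vec.dim (Rep_proj p) = 1"
    using Rep_proj[of p] by auto
  have v: "v \<in> Rep_proj p" "v \<noteq> 0" using assms by (auto simp: hom_coords_def)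
  have ind: "vec.independent {v}" using v by (simp add: vec.independent_insert)
  have "vec.span {v} \<subseteq> Rep_proj p"
    using v p by (intro vec.span_minimal) auto
  moreover have "vec.dim (vec.span {v}) = 1"
    using ind by (simp add: vec.dim_eq_card_independent)
  ultimately show ?thesis
    using p by (intro vec.subspace_dim_equal[symmetric]) auto
qed

lemma hom_coords_proportional:
  assumes "v \<in> hom_coords p" "w \<in> hom_coords p"
  obtains c where "c \<noteq> 0" "w = c *s v"
proof -
  have "w \<in> vec.span {v}" "w \<noteq> 0"
    using assms Rep_proj_eq_span[OF assms(1)] by (auto simp: hom_coords_def)
  then show ?thesis using that by (auto simp: vec.span_singleton)
qed

lemma hom_coords_scaled:
  assumes "v \<in> hom_coords p" "c \<noteq> 0" "c *s v \<in> hom_coords q"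
  shows "p = q"
proof -
  have "Rep_proj p = vec.span {v}" "Rep_proj q = vec.span {c *s v}"
    using assms Rep_proj_eq_span by blast+
  moreover have "vec.span {c *s v} = vec.span {v}"
    using assms(2) by (simp add: vec.span_image_scale[of "{v}" "\<lambda>_. c", simplified])
  ultimately show ?thesis by (simp flip: Rep_proj_inject)
qed

text \<open>
  The global quotients of forms that regular functions are glued from.  As a predicate of its own it
  lets the ring operations be checked once on quotients, without the covering open sets.
\<close>

definition form_quotient :: "('n::finite proj \<Rightarrow> complex) \<Rightarrow> 'n proj set \<Rightarrow> bool" where
  "form_quotient f A \<longleftrightarrow> (\<exists>d F G. form d F \<and> form d G \<and>
     (\<forall>q\<in>A. \<forall>v\<in>hom_coords q. G v \<noteq> 0 \<and> f q = F v / G v))"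

lemma form_quotientI:
  assumes "form d F" "form d G" "\<And>q v. q \<in> A \<Longrightarrow> v \<in> hom_coords q \<Longrightarrow> G v \<noteq> 0 \<and> f q = F v / G v"
  shows "form_quotient f A"
  unfolding form_quotient_def using assms
  by (intro exI[of _ d] exI[of _ F] exI[of _ G] conjI ballI) blast+

lemma form_quotientE:
  assumes "form_quotient f A"
  obtains d F G where "form d F" "form d G"
    "\<And>q v. q \<in> A \<Longrightarrow> v \<in> hom_coords q \<Longrightarrow> G v \<noteq> 0"
    "\<And>q v. q \<in> A \<Longrightarrow> v \<in> hom_coords q \<Longrightarrow> f q = F v / G v"
proof -
  obtain d F G where "form d F \<and> form d G \<and>
     (\<forall>q\<in>A. \<forall>v\<in>hom_coords q. G v \<noteq> 0 \<and> f q = F v / G v)"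
    using assms unfolding form_quotient_def by (elim exE)
  then show thesis by (intro that[of d F G]) simp_all
qed

lemma form_quotient_mono:
  assumes "form_quotient g A" "B \<subseteq> A" "\<And>q. q \<in> B \<Longrightarrow> f q = g q"
  shows "form_quotient f B"
proof -
  obtain d F G where *: "form d F" "form d G" "\<And>q v. q \<in> A \<Longrightarrow> v \<in> hom_coords q \<Longrightarrow> G v \<noteq> 0"
    "\<And>q v. q \<in> A \<Longrightarrow> v \<in> hom_coords q \<Longrightarrow> g q = F v / G v"
    using assms(1) by (rule form_quotientE) blast
  show ?thesis
  proof (rule form_quotientI[OF *(1,2)])
    fix q v assume "q \<in> B" "v \<in> hom_coords q"
    then show "G v \<noteq> 0 \<and> f q = F v / G v"
      using *(3,4)[of q v] assms(2,3) by auto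
  qed
qed

lemma form_quotient_const: "form_quotient (\<lambda>q. c) A"
  by (rule form_quotientI[of 0 "\<lambda>v. c" "\<lambda>v. 1"]) (auto intro: form.const)

lemma form_quotient_add_mult_divide:
  assumes "form_quotient f A" "form_quotient g A"
  shows "form_quotient (\<lambda>q. f q + g q) A" "form_quotient (\<lambda>q. f q * g q) A"
    "(\<And>q. q \<in> A \<Longrightarrow> g q \<noteq> 0) \<Longrightarrow> form_quotient (\<lambda>q. f q / g q) A"
proof -
  obtain d F G where 1: "form d F" "form d G" "\<And>q v. q \<in> A \<Longrightarrow> v \<in> hom_coords q \<Longrightarrow> G v \<noteq> 0"
    "\<And>q v. q \<in> A \<Longrightarrow> v \<in> hom_coords q \<Longrightarrow> f q = F v / G v"
    using assms(1) by (rule form_quotientE) blast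
  obtain d' F' G' where 2: "form d' F'" "form d' G'" "\<And>q v. q \<in> A \<Longrightarrow> v \<in> hom_coords q \<Longrightarrow> G' v \<noteq> 0"
    "\<And>q v. q \<in> A \<Longrightarrow> v \<in> hom_coords q \<Longrightarrow> g q = F' v / G' v"
    using assms(2) by (rule form_quotientE) blast
  note forms = form.mult[OF 1(1) 2(1)] form.mult[OF 1(1) 2(2)] form.mult[OF 1(2) 2(1)] form.mult[OF 1(2) 2(2)]
  show "form_quotient (\<lambda>q. f q + g q) A"
  proof (rule form_quotientI[OF form.add[OF forms(2) forms(3)] forms(4)])
    fix q v assume q: "q \<in> A" "v \<in> hom_coords q"
    then show "G v * G' v \<noteq> 0 \<and> f q + g q = (F v * G' v + G v * F' v) / (G v * G' v)"
      using 1(3)[OF q] 2(3)[OF q] unfolding 1(4)[OF q] 2(4)[OF q] by (simp add: field_simps)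
  qed
  show "form_quotient (\<lambda>q. f q * g q) A"
  proof (rule form_quotientI[OF forms(1) forms(4)])
    fix q v assume q: "q \<in> A" "v \<in> hom_coords q"
    then show "G v * G' v \<noteq> 0 \<and> f q * g q = (F v * F' v) / (G v * G' v)"
      using 1(3)[OF q] 2(3)[OF q] unfolding 1(4)[OF q] 2(4)[OF q] by simp
  qed
  show "form_quotient (\<lambda>q. f q / g q) A" if nz: "\<And>q. q \<in> A \<Longrightarrow> g q \<noteq> 0"
  proof (rule form_quotientI[OF forms(2) forms(3)])
    fix q v assume q: "q \<in> A" "v \<in> hom_coords q"
    then show "G v * F' v \<noteq> 0 \<and> f q / g q = (F v * G' v) / (G v * F' v)"
      using 1(3)[OF q] 2(3)[OF q] nz[OF q(1)] unfolding 1(4)[OF q] 2(4)[OF q] by simp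
  qed
qed

text \<open>
  A quotient of forms of equal degree does not depend on the choice of homogeneous coordinates, and
  neither does the nonvanishing of its denominator.
\<close>

lemma global_form_quotient:
  fixes F G :: "complex^'n::finite \<Rightarrow> complex"
  assumes "form d F" "form d G"
  obtains U f where "openin proj_zariski U" "\<And>q v. v \<in> hom_coords q \<Longrightarrow> q \<in> U \<longleftrightarrow> G v \<noteq> 0"
    "\<And>q v. v \<in> hom_coords q \<Longrightarrow> f q = F v / G v" "form_quotient f U"
proof -
  define U where "U = {p. \<forall>v\<in>hom_coords p. G v \<noteq> 0}"
  define f where "f q = (let v = SOME v. v \<in> hom_coords q in F v / G v)" for q :: "'n proj"
  have f: "f q = F v / G v" if v: "v \<in> hom_coords q" for q v
  proof -
    define w where "w = (SOME v. v \<in> hom_coords q)"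
    have "w \<in> hom_coords q" unfolding w_def by (rule someI_ex[OF hom_coords_nonempty])
    then obtain c where "c \<noteq> 0" "w = c *s v" using hom_coords_proportional[OF v] by metis
    then have "F w / G w = F v / G v"
      by (simp add: form_scale[OF assms(1)] form_scale[OF assms(2)])
    then show ?thesis by (simp add: f_def w_def[symmetric])
  qed
  have "openin proj_zariski U" unfolding U_def by (rule openin_form_nonzero) fact
  moreover have "q \<in> U \<longleftrightarrow> G v \<noteq> 0" if v: "v \<in> hom_coords q" for q v
  proof -
    have "G w \<noteq> 0" if w: "w \<in> hom_coords q" "G v \<noteq> 0" for w
    proof -
      obtain c where "c \<noteq> 0" "w = c *s v" using hom_coords_proportional[OF v w(1)] by metis
      then show ?thesis using w(2) by (simp add: form_scale[OF assms(2)])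
    qed
    then show ?thesis using v by (auto simp: U_def)
  qed
  moreover have "form_quotient f U"
    by (rule form_quotientI[OF assms]) (simp add: U_def f)
  ultimately show thesis using that f by blast
qed

lemma regular_proj_space_iff:
  "f \<in> regular proj_space U \<longleftrightarrow>
    (\<forall>p\<in>U. \<exists>W. openin proj_zariski W \<and> p \<in> W \<and> form_quotient f (W \<inter> U))"
  by (simp add: proj_space_def form_quotient_def)

text \<open>
  The structure sheaf of a subset is defined by restricting regular functions of the ambient space;
  both descriptions agree because a local quotient of forms extends to the open set where its
  denominator does not vanish.
\<close>

lemma regular_proj_variety_iff:
  fixes C :: "'n::finite proj set"
  shows "f \<in> regular (proj_variety C) U \<longleftrightarrow>
    (\<forall>p\<in>U. \<exists>W. openin proj_zariski W \<and> p \<in> W \<and> form_quotient f (W \<inter> U))"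
    (is "_ \<longleftrightarrow> ?R")
proof
  assume f: "f \<in> regular (proj_variety C) U"
  show ?R
  proof
    fix p assume "p \<in> U"
    with f obtain W g where W: "openin proj_zariski W" "p \<in> W" "g \<in> regular proj_space W"
      "\<And>x. x \<in> W \<inter> U \<Longrightarrow> f x = g x"
      by (auto simp: induced_def proj_space_def)
    then obtain W' where W': "openin proj_zariski W'" "p \<in> W'" "form_quotient g (W' \<inter> W)"
      unfolding regular_proj_space_iff by blast
    then show "\<exists>W. openin proj_zariski W \<and> p \<in> W \<and> form_quotient f (W \<inter> U)"
      using W by (intro exI[of _ "W' \<inter> W"] conjI form_quotient_mono[OF W'(3)]) auto
  qed
next
  assume R: ?R
  have "\<exists>W. openin proj_zariski W \<and> p \<in> W \<and> (\<exists>g\<in>regular proj_space W. \<forall>x\<in>W \<inter> U. f x = g x)"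
    if p: "p \<in> U" for p
  proof -
    obtain W where W: "openin proj_zariski W" "p \<in> W" "form_quotient f (W \<inter> U)"
      using R p by blast
    obtain d F G where FG: "form d F" "form d G"
      "\<And>q v. q \<in> W \<inter> U \<Longrightarrow> v \<in> hom_coords q \<Longrightarrow> G v \<noteq> 0"
      "\<And>q v. q \<in> W \<inter> U \<Longrightarrow> v \<in> hom_coords q \<Longrightarrow> f q = F v / G v"
      using W(3) by (rule form_quotientE) blast
    obtain V g where V: "openin proj_zariski V" "\<And>q v. v \<in> hom_coords q \<Longrightarrow> q \<in> V \<longleftrightarrow> G v \<noteq> 0"
      "\<And>q v. v \<in> hom_coords q \<Longrightarrow> g q = F v / G v" "form_quotient g V"
      using FG(1,2) by (rule global_form_quotient) blast
    have WU: "q \<in> V \<and> f q = g q" if q: "q \<in> W \<inter> U" for q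
    proof -
      obtain v where v: "v \<in> hom_coords q" using hom_coords_nonempty by blast
      then show ?thesis using FG(3,4)[OF q v] V(2,3)[OF v] by simp
    qed
    moreover have "g \<in> regular proj_space (W \<inter> V)"
      unfolding regular_proj_space_iff
      using V(1) W(1) form_quotient_mono[OF V(4)] by (intro ballI exI[of _ V]) auto
    ultimately show ?thesis using V(1) W(1,2) p
      by (intro exI[of _ "W \<inter> V"] conjI bexI[of _ g]) auto
  qed
  then show "f \<in> regular (proj_variety C) U"
    by (auto simp: induced_def proj_space_def)
qed

text \<open>
  The properties of a quasi-projective variety that are used below: its regular functions form a sheaf
  of rings in which nonvanishing functions are invertible, nonvanishing loci are open, and any two points
  are separated by a regular function defined at both.  The last property is what makes
  diagonals closed in the product.
\<close>

locale function_space =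
  fixes X :: "'a fspace"
  assumes regular_const: "(\<lambda>x. c) \<in> regular X U"
    and regular_restrict: "f \<in> regular X U \<Longrightarrow> V \<subseteq> U \<Longrightarrow> f \<in> regular X V"
    and regular_local: "(\<And>p. p \<in> U \<Longrightarrow>
          \<exists>W g. openin (zariski X) W \<and> p \<in> W \<and> g \<in> regular X (W \<inter> U) \<and> (\<forall>x\<in>W \<inter> U. f x = g x)) \<Longrightarrow>
        f \<in> regular X U"
    and regular_add: "f \<in> regular X U \<Longrightarrow> g \<in> regular X U \<Longrightarrow> (\<lambda>x. f x + g x) \<in> regular X U"
    and regular_mult: "f \<in> regular X U \<Longrightarrow> g \<in> regular X U \<Longrightarrow> (\<lambda>x. f x * g x) \<in> regular X U"
    and regular_divide: "f \<in> regular X U \<Longrightarrow> g \<in> regular X U \<Longrightarrow> (\<And>x. x \<in> U \<Longrightarrow> g x \<noteq> 0) \<Longrightarrow>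
        (\<lambda>x. f x / g x) \<in> regular X U"
    and open_nonzero: "openin (zariski X) U \<Longrightarrow> f \<in> regular X U \<Longrightarrow>
        openin (zariski X) {x \<in> U. f x \<noteq> 0}"
    and points_separated: "p \<in> points X \<Longrightarrow> q \<in> points X \<Longrightarrow> p \<noteq> q \<Longrightarrow>
        \<exists>U f. openin (zariski X) U \<and> p \<in> U \<and> q \<in> U \<and> f \<in> regular X U \<and> f p \<noteq> f q"

lemma zariski_proj_variety: "zariski (proj_variety C) = subtopology proj_zariski C"
  by (simp add: induced_def proj_space_def)

lemma points_proj_variety [simp]: "points (proj_variety C) = C"
  by (simp add: zariski_proj_variety topspace_subtopology topspace_proj_zariski)

text \<open>
  Some linear form \<open>G\<close> vanishes at neither point: one of the coordinates, or the sum of two of them.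
  If all coordinate functions divided by \<open>G\<close> took equal values, the coordinate vectors would be
  proportional.
\<close>

lemma form_separates_points:
  fixes p q :: "'n::finite proj"
  assumes "p \<noteq> q" and v: "v \<in> hom_coords p" and w: "w \<in> hom_coords q"
  obtains F G where "form 1 F" "form 1 G" "G v \<noteq> 0" "G w \<noteq> 0" "F v / G v \<noteq> F w / G w"
proof -
  have "v \<noteq> 0" "w \<noteq> 0" using v w by (auto simp: hom_coords_def)
  then obtain i j where ij: "v $ i \<noteq> 0" "w $ j \<noteq> 0" by (metis vec_eq_iff zero_index)
  have "\<exists>G. form 1 G \<and> G v \<noteq> 0 \<and> G w \<noteq> 0"
  proof -
    consider "w $ i \<noteq> 0" | "v $ j \<noteq> 0" | "w $ i = 0" "v $ j = 0" by blast
    then show ?thesis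
    proof cases
      case 1
      then show ?thesis using ij by (intro exI[of _ "\<lambda>u. u $ i"] conjI form.coord)
    next
      case 2
      then show ?thesis using ij by (intro exI[of _ "\<lambda>u. u $ j"] conjI form.coord)
    next
      case 3
      then show ?thesis using ij
        by (intro exI[of _ "\<lambda>u. u $ i + u $ j"]) (intro conjI form.coord form.add, auto)
    qed
  qed
  then obtain G where G: "form 1 G" "G v \<noteq> 0" "G w \<noteq> 0" by blast
  have "\<exists>k. v $ k / G v \<noteq> w $ k / G w"
  proof (rule ccontr)
    assume "\<not> ?thesis"
    then have "w = (G w / G v) *s v"
      using G by (simp add: vec_eq_iff field_simps)
    then have "p = q" using hom_coords_scaled[OF v, of "G w / G v" q] w G by simp
    then show False using assms by simp
  qed
  then show thesis using that G form.coord by blast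
qed

lemma function_space_proj_variety: "function_space (proj_variety C)"
proof (rule function_space.intro)
  let ?X = "proj_variety C"
  have sub: "openin (zariski ?X) W \<longleftrightarrow> (\<exists>T. openin proj_zariski T \<and> W = T \<inter> C)" for W
    by (simp add: zariski_proj_variety openin_subtopology)
  have regI: "f \<in> regular ?X U"
    if "\<And>p. p \<in> U \<Longrightarrow> \<exists>W. openin proj_zariski W \<and> p \<in> W \<and> form_quotient f (W \<inter> U)" for f U
    using that by (simp add: regular_proj_variety_iff)
  have regE: "\<exists>W. openin proj_zariski W \<and> p \<in> W \<and> form_quotient f (W \<inter> U)"
    if "f \<in> regular ?X U" "p \<in> U" for f U p
    using that by (simp add: regular_proj_variety_iff)
  have two: "\<exists>W. openin proj_zariski W \<and> p \<in> W \<and> form_quotient f (W \<inter> U) \<and> form_quotient g (W \<inter> U)"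
    if f: "f \<in> regular ?X U" and g: "g \<in> regular ?X U" and p: "p \<in> U" for f g U p
  proof -
    obtain W where 1: "openin proj_zariski W" "p \<in> W" "form_quotient f (W \<inter> U)"
      using regE[OF f p] by blast
    obtain W' where 2: "openin proj_zariski W'" "p \<in> W'" "form_quotient g (W' \<inter> U)"
      using regE[OF g p] by blast
    show ?thesis
      using 1(1,2) 2(1,2)
      by (intro exI[of _ "W \<inter> W'"] conjI form_quotient_mono[OF 1(3)] form_quotient_mono[OF 2(3)]) auto
  qed
  show "(\<lambda>x. c) \<in> regular ?X U" for c U
  proof (rule regI)
    fix p
    show "\<exists>W. openin proj_zariski W \<and> p \<in> W \<and> form_quotient (\<lambda>x. c) (W \<inter> U)"
      using openin_topspace[of proj_zariski] form_quotient_const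
      by (intro exI[of _ UNIV]) (auto simp: topspace_proj_zariski)
  qed
  show restr: "f \<in> regular ?X V" if f: "f \<in> regular ?X U" and VU: "V \<subseteq> U" for f U V
  proof (rule regI)
    fix p assume "p \<in> V"
    then obtain W where W: "openin proj_zariski W" "p \<in> W" "form_quotient f (W \<inter> U)"
      using regE[OF f] VU by blast
    then show "\<exists>W. openin proj_zariski W \<and> p \<in> W \<and> form_quotient f (W \<inter> V)"
      using VU by (intro exI[of _ W] conjI form_quotient_mono[OF W(3)]) auto
  qed
  show "f \<in> regular ?X U"
    if loc: "\<And>p. p \<in> U \<Longrightarrow> \<exists>W g. openin (zariski ?X) W \<and> p \<in> W \<and> g \<in> regular ?X (W \<inter> U) \<and> (\<forall>x\<in>W \<inter> U. f x = g x)"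
    for f U
  proof (rule regI)
    fix p assume p: "p \<in> U"
    have UC: "U \<subseteq> C"
    proof
      fix x assume "x \<in> U"
      then obtain W where "openin (zariski ?X) W" "x \<in> W" using loc[of x] by blast
      then show "x \<in> C" by (auto simp: sub)
    qed
    obtain W g where W: "openin (zariski ?X) W" "p \<in> W" "g \<in> regular ?X (W \<inter> U)" "\<forall>x\<in>W \<inter> U. f x = g x"
      using loc[OF p] by blast
    obtain T where T: "openin proj_zariski T" "W = T \<inter> C" using W(1) sub by auto
    obtain W' where W': "openin proj_zariski W'" "p \<in> W'" "form_quotient g (W' \<inter> (W \<inter> U))"
      using regE[OF W(3)] W(2) p by blast
    show "\<exists>W. openin proj_zariski W \<and> p \<in> W \<and> form_quotient f (W \<inter> U)"
    proof (intro exI conjI)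
      show "openin proj_zariski (T \<inter> W')" using T(1) W'(1) by blast
      show "p \<in> T \<inter> W'" using T(2) W(2) W'(2) by blast
      show "form_quotient f (T \<inter> W' \<inter> U)"
        by (rule form_quotient_mono[OF W'(3)]) (use UC T(2) W(4) in auto)
    qed
  qed
  show "(\<lambda>x. f x + g x) \<in> regular ?X U"
    if f: "f \<in> regular ?X U" and g: "g \<in> regular ?X U" for f g U
  proof (rule regI)
    fix p assume "p \<in> U"
    then obtain W where W: "openin proj_zariski W" "p \<in> W" "form_quotient f (W \<inter> U)" "form_quotient g (W \<inter> U)"
      using two[OF f g] by blast
    show "\<exists>W. openin proj_zariski W \<and> p \<in> W \<and> form_quotient (\<lambda>x. f x + g x) (W \<inter> U)"
      using W(1,2) form_quotient_add_mult_divide(1)[OF W(3,4)] by blast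
  qed
  show "(\<lambda>x. f x * g x) \<in> regular ?X U"
    if f: "f \<in> regular ?X U" and g: "g \<in> regular ?X U" for f g U
  proof (rule regI)
    fix p assume "p \<in> U"
    then obtain W where W: "openin proj_zariski W" "p \<in> W" "form_quotient f (W \<inter> U)" "form_quotient g (W \<inter> U)"
      using two[OF f g] by blast
    show "\<exists>W. openin proj_zariski W \<and> p \<in> W \<and> form_quotient (\<lambda>x. f x * g x) (W \<inter> U)"
      using W(1,2) form_quotient_add_mult_divide(2)[OF W(3,4)] by blast
  qed
  show "(\<lambda>x. f x / g x) \<in> regular ?X U"
    if f: "f \<in> regular ?X U" and g: "g \<in> regular ?X U" and nz: "\<And>x. x \<in> U \<Longrightarrow> g x \<noteq> 0" for f g U
  proof (rule regI)
    fix p assume "p \<in> U"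
    then obtain W where W: "openin proj_zariski W" "p \<in> W" "form_quotient f (W \<inter> U)" "form_quotient g (W \<inter> U)"
      using two[OF f g] by blast
    show "\<exists>W. openin proj_zariski W \<and> p \<in> W \<and> form_quotient (\<lambda>x. f x / g x) (W \<inter> U)"
      using W(1,2) nz by (intro exI[of _ W] conjI form_quotient_add_mult_divide(3)[OF W(3,4)]) auto
  qed
  show "openin (zariski ?X) {x \<in> U. f x \<noteq> 0}" if U: "openin (zariski ?X) U" and f: "f \<in> regular ?X U" for f U
  proof (subst openin_subopen, intro ballI)
    fix p assume p: "p \<in> {x \<in> U. f x \<noteq> 0}"
    then obtain W where W: "openin proj_zariski W" "p \<in> W" "form_quotient f (W \<inter> U)"
      using regE[OF f] by blast
    obtain d F G where FG: "form d F" "form d G"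
      "\<And>q v. q \<in> W \<inter> U \<Longrightarrow> v \<in> hom_coords q \<Longrightarrow> G v \<noteq> 0"
      "\<And>q v. q \<in> W \<inter> U \<Longrightarrow> v \<in> hom_coords q \<Longrightarrow> f q = F v / G v"
      using W(3) by (rule form_quotientE) blast
    obtain T where T: "openin proj_zariski T" "U = T \<inter> C" using U sub by auto
    define V where "V = W \<inter> T \<inter> {q. \<forall>v\<in>hom_coords q. F v \<noteq> 0}"
    have "openin proj_zariski V"
      unfolding V_def by (intro openin_Int W(1) T(1) openin_form_nonzero[OF FG(1)])
    then have "openin (zariski ?X) (V \<inter> C)" using sub by blast
    moreover have "F v \<noteq> 0" if "v \<in> hom_coords p" for v
      using FG(4)[of p v] that W(2) p by auto
    then have "p \<in> V \<inter> C" using p W(2) T(2) by (auto simp: V_def)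
    moreover have "V \<inter> C \<subseteq> {x \<in> U. f x \<noteq> 0}"
    proof
      fix x assume x: "x \<in> V \<inter> C"
      obtain v where v: "v \<in> hom_coords x" using hom_coords_nonempty by blast
      have "x \<in> W \<inter> U" "F v \<noteq> 0" using x T(2) v by (auto simp: V_def)
      then show "x \<in> {x \<in> U. f x \<noteq> 0}" using FG(3,4)[of x v] v by auto
    qed
    ultimately show "\<exists>T. openin (zariski ?X) T \<and> p \<in> T \<and> T \<subseteq> {x \<in> U. f x \<noteq> 0}" by blast
  qed
  show "\<exists>U f. openin (zariski ?X) U \<and> p \<in> U \<and> q \<in> U \<and> f \<in> regular ?X U \<and> f p \<noteq> f q"
    if pq: "p \<in> points ?X" "q \<in> points ?X" "p \<noteq> q" for p q
  proof -
    obtain v w where vw: "v \<in> hom_coords p" "w \<in> hom_coords q" using hom_coords_nonempty by blast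
    obtain F G where FG: "form 1 F" "form 1 G" "G v \<noteq> 0" "G w \<noteq> 0" "F v / G v \<noteq> F w / G w"
      using form_separates_points[OF pq(3) vw] by metis
    obtain U f where U: "openin proj_zariski U" "\<And>q v. v \<in> hom_coords q \<Longrightarrow> q \<in> U \<longleftrightarrow> G v \<noteq> 0"
      "\<And>q v. v \<in> hom_coords q \<Longrightarrow> f q = F v / G v" "form_quotient f U"
      using FG(1,2) by (rule global_form_quotient) blast
    have "f \<in> regular ?X (U \<inter> C)"
    proof (rule regI)
      fix p assume "p \<in> U \<inter> C"
      then show "\<exists>W. openin proj_zariski W \<and> p \<in> W \<and> form_quotient f (W \<inter> (U \<inter> C))"
        using U(1) form_quotient_mono[OF U(4)] by (intro exI[of _ U]) auto
    qed
    moreover have "openin (zariski ?X) (U \<inter> C)" using U(1) sub by blast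
    moreover have "p \<in> U \<inter> C" "q \<in> U \<inter> C" using U(2) vw FG(3,4) pq by auto
    moreover have "f p \<noteq> f q" using U(3) vw FG(5) by auto
    ultimately show ?thesis by blast
  qed
qed

section \<open>Coordinate maps and the order of vanishing\<close>

lemma points_induced: "points (induced Y Z) = points Y \<inter> Z"
  by (simp add: induced_def)

lemma openin_power_space:
  assumes "\<And>i. i \<in> I \<Longrightarrow> openin (zariski X) (U i)" "box_function X I U h"
  shows "openin (zariski (power_space X I)) {x \<in> Pi\<^sub>E I U. h x \<noteq> 0}"
  unfolding power_space_def using assms by (auto intro!: topology_generated_by_Basis)

lemma openin_power_space_box:
  assumes "\<And>i. i \<in> I \<Longrightarrow> openin (zariski X) (U i)"
  shows "openin (zariski (power_space X I)) (Pi\<^sub>E I U)"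
  using openin_power_space[OF assms box_function.const[of X I U 1]] by simp

lemma points_power_space: "points (power_space X I) = (\<Pi>\<^sub>E i\<in>I. points X)"
proof
  show "(\<Pi>\<^sub>E i\<in>I. points X) \<subseteq> points (power_space X I)"
    by (intro openin_subset openin_power_space_box) auto
  have "Pi\<^sub>E I U \<subseteq> (\<Pi>\<^sub>E i\<in>I. points X)" if "\<forall>i\<in>I. openin (zariski X) (U i)" for U
    using that by (intro PiE_mono openin_subset) auto
  then show "points (power_space X I) \<subseteq> (\<Pi>\<^sub>E i\<in>I. points X)"
    by (auto simp: power_space_def; blast)
qed

lemma regular_power_space:
  assumes "\<And>i. i \<in> I \<Longrightarrow> openin (zariski X) (U i)" "box_function X I U h"
  shows "h \<in> regular (power_space X I) (Pi\<^sub>E I U)"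
proof -
  have "\<exists>U' g k. (\<forall>i\<in>I. openin (zariski X) (U' i)) \<and> box_function X I U' g \<and> box_function X I U' k \<and>
      p \<in> Pi\<^sub>E I U' \<and> k p \<noteq> 0 \<and> (\<forall>x\<in>Pi\<^sub>E I U \<inter> Pi\<^sub>E I U'. k x \<noteq> 0 \<longrightarrow> h x = g x / k x)"
    if "p \<in> Pi\<^sub>E I U" for p
    using assms that by (intro exI[of _ U] exI[of _ h] exI[of _ "\<lambda>x. 1"]) (auto intro: box_function.const)
  then show ?thesis by (simp add: power_space_def)
qed

lemma openin_finite_coordinates:
  assumes "finite I" "\<And>i. i \<in> I \<Longrightarrow> openin T {p \<in> topspace T. P i p}"
  shows "openin T {p \<in> topspace T. \<forall>i\<in>I. P i p}"
  using assms
proof (induction I)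
  case (insert i I)
  have "{p \<in> topspace T. \<forall>i\<in>insert i I. P i p} = {p \<in> topspace T. P i p} \<inter> {p \<in> topspace T. \<forall>i\<in>I. P i p}"
    by auto
  then show ?case using insert by auto
qed simp

definition coordinate_map :: "'a set \<Rightarrow> 'i set \<Rightarrow> ('i \<Rightarrow> 'a option) \<Rightarrow> 'a \<Rightarrow> 'i \<Rightarrow> 'a" where
  "coordinate_map P I w = (\<lambda>p\<in>P. \<lambda>i\<in>I. case w i of None \<Rightarrow> p | Some c \<Rightarrow> c)"

context function_space
begin

lemma regular_cong:
  assumes "openin (zariski X) U" "g \<in> regular X U" "\<And>x. x \<in> U \<Longrightarrow> f x = g x"
  shows "f \<in> regular X U"
proof (rule regular_local)
  fix p assume "p \<in> U"
  then show "\<exists>W g. openin (zariski X) W \<and> p \<in> W \<and> g \<in> regular X (W \<inter> U) \<and> (\<forall>x\<in>W \<inter> U. f x = g x)"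
    using assms by (intro exI[of _ U] exI[of _ g]) auto
qed

context
  fixes I :: "'i set" and w :: "'i \<Rightarrow> 'a option" and e i0
  assumes fin: "finite I" and w: "w ` I \<subseteq> insert None (Some ` points X)"
    and i0: "i0 \<in> I" "w i0 = None"
  defines e_def: "e \<equiv> coordinate_map (points X) I w"
begin

lemma coordinate_map_apply:
  "p \<in> points X \<Longrightarrow> i \<in> I \<Longrightarrow> e p i = (case w i of None \<Rightarrow> p | Some c \<Rightarrow> c)"
  by (simp add: e_def coordinate_map_def)

lemma coordinate_map_retraction: "p \<in> points X \<Longrightarrow> e p i0 = p"
  using i0 by (simp add: coordinate_map_apply)

lemma coordinate_map_points: "p \<in> points X \<Longrightarrow> e p \<in> (\<Pi>\<^sub>E i\<in>I. points X)"
  using w by (force simp: e_def coordinate_map_def split: option.splits)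

text \<open>
  The preimage of a box is the intersection over the coordinates of \<open>U\<^sub>i\<close> (for a star) and of everything
  or nothing (for a constant).
\<close>

lemma openin_coordinate_map_box:
  assumes "\<And>i. i \<in> I \<Longrightarrow> openin (zariski X) (U i)"
  shows "openin (zariski X) {p \<in> points X. e p \<in> Pi\<^sub>E I U}"
proof -
  have "openin (zariski X) {p \<in> points X. e p i \<in> U i}" if i: "i \<in> I" for i
  proof (cases "w i")
    case None
    then have "{p \<in> points X. e p i \<in> U i} = U i"
      using openin_subset[OF assms[OF i]] i by (auto simp: coordinate_map_apply)
    then show ?thesis using assms i by simp
  next
    case (Some c)
    then have "{p \<in> points X. e p i \<in> U i} = (if c \<in> U i then points X else {})"
      using i by (auto simp: coordinate_map_apply)
    then show ?thesis by simp
  qed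
  then have "openin (zariski X) {p \<in> points X. \<forall>i\<in>I. e p i \<in> U i}"
    by (rule openin_finite_coordinates[OF fin])
  moreover have "{p \<in> points X. \<forall>i\<in>I. e p i \<in> U i} = {p \<in> points X. e p \<in> Pi\<^sub>E I U}"
    using coordinate_map_points by (auto simp: PiE_iff)
  ultimately show ?thesis by simp
qed

text \<open>
  A coordinate function pulls back to itself or to a constant, and box functions are polynomials in
  coordinate functions.
\<close>

lemma regular_box_function_coordinate_map:
  assumes "box_function X I U h" "openin (zariski X) V" "\<And>p. p \<in> V \<Longrightarrow> e p \<in> Pi\<^sub>E I U"
  shows "(\<lambda>p. h (e p)) \<in> regular X V"
  using assms(1)
proof induction
  case (pullback i f)
  have V: "V \<subseteq> points X" using assms(2) by (rule openin_subset)
  show ?case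
  proof (cases "w i")
    case None
    then have eq: "e p i = p" if "p \<in> V" for p
      using that V pullback(1) by (auto simp: coordinate_map_apply)
    then have "V \<subseteq> U i" using assms(3) pullback(1) by (force simp: PiE_iff)
    then have "f \<in> regular X V" by (rule regular_restrict[OF pullback(2)])
    then show ?thesis by (rule regular_cong[OF assms(2)]) (simp add: eq)
  next
    case (Some c)
    show ?thesis
      by (rule regular_cong[OF assms(2) regular_const[of "f c"]])
        (use V Some pullback(1) in \<open>auto simp: coordinate_map_apply\<close>)
  qed
qed (simp_all add: regular_const regular_add regular_mult)

lemma openin_coordinate_map_basic:
  assumes "\<And>i. i \<in> I \<Longrightarrow> openin (zariski X) (U i)" "box_function X I U h"
  shows "openin (zariski X) {p \<in> points X. e p \<in> Pi\<^sub>E I U \<and> h (e p) \<noteq> 0}"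
proof -
  let ?V = "{p \<in> points X. e p \<in> Pi\<^sub>E I U}"
  have V: "openin (zariski X) ?V" using assms(1) by (rule openin_coordinate_map_box)
  then have "(\<lambda>p. h (e p)) \<in> regular X ?V"
    by (rule regular_box_function_coordinate_map[OF assms(2)]) simp
  then have "openin (zariski X) {p \<in> ?V. h (e p) \<noteq> 0}" by (rule open_nonzero[OF V])
  then show ?thesis by (simp add: conj_assoc)
qed

lemma continuous_map_coordinate_map:
  "continuous_map (zariski X) (zariski (power_space X I)) e"
proof -
  have "e ` points X \<subseteq> points (power_space X I)"
    using coordinate_map_points by (auto simp: points_power_space)
  moreover have "openin (zariski X) (e -` {x \<in> Pi\<^sub>E I U. h x \<noteq> 0} \<inter> points X)"
    if "\<forall>i\<in>I. openin (zariski X) (U i)" "box_function X I U h" for U h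
  proof -
    have "e -` {x \<in> Pi\<^sub>E I U. h x \<noteq> 0} \<inter> points X = {p \<in> points X. e p \<in> Pi\<^sub>E I U \<and> h (e p) \<noteq> 0}"
      by auto
    then show ?thesis using openin_coordinate_map_basic that by simp
  qed
  ultimately show ?thesis
    unfolding power_space_def by (auto intro!: continuous_on_generated_topo)
qed

text \<open>
  The image is cut out by equations \<open>y\<^sub>i = c\<close> for the constant letters and \<open>y\<^sub>i = y\<^sub>i\<^sub>0\<close> for the stars, where \<open>i0\<close>
  is a fixed star.  If \<open>y\<close> violates one of them, a function \<open>f\<close> separating the two sides gives a box
  function, \<open>f(y\<^sub>i) - f(c)\<close> or \<open>f(y\<^sub>i) - f(y\<^sub>i\<^sub>0)\<close>, that vanishes on the image but not at \<open>y\<close>.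
\<close>

lemma closedin_coordinate_map_image:
  "closedin (zariski (power_space X I)) (e ` points X)"
proof -
  let ?Y = "power_space X I"
  have "\<exists>T. openin (zariski ?Y) T \<and> y \<in> T \<and> T \<subseteq> points ?Y - e ` points X"
    if y: "y \<in> points ?Y - e ` points X" for y
  proof -
    have yI: "y \<in> (\<Pi>\<^sub>E i\<in>I. points X)" using y by (simp add: points_power_space)
    have yi: "y i \<in> points X" if "i \<in> I" for i using PiE_mem[OF yI that] .
    have "\<exists>i\<in>I. y i \<noteq> e (y i0) i"
    proof (rule ccontr)
      assume "\<not> ?thesis"
      then have "y = e (y i0)"
        using coordinate_map_points[OF yi[OF i0(1)]] by (intro PiE_ext[OF yI]) auto
      then show False using y yi[OF i0(1)] by blast
    qed
    then obtain i where i: "i \<in> I" "y i \<noteq> e (y i0) i" by blast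
    show ?thesis
    proof (cases "w i")
      case None
      then have ne: "y i \<noteq> y i0" using i yi[OF i0(1)] by (simp add: coordinate_map_apply)
      obtain U f where U: "openin (zariski X) U" "y i \<in> U" "y i0 \<in> U" "f \<in> regular X U" "f (y i) \<noteq> f (y i0)"
        using points_separated[OF yi[OF i(1)] yi[OF i0(1)] ne] by blast
      define B where "B j = (if j = i \<or> j = i0 then U else points X)" for j
      define h where "h x = f (x i) + (- 1) * f (x i0)" for x :: "'i \<Rightarrow> 'a"
      have B: "openin (zariski X) (B j)" for j using U(1) by (simp add: B_def)
      have "box_function X I B h"
        unfolding h_def using U(4) i(1) i0(1)
        by (intro box_function.intros) (auto simp: B_def)
      then have "openin (zariski ?Y) {x \<in> Pi\<^sub>E I B. h x \<noteq> 0}"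
        using B by (intro openin_power_space)
      moreover have "y \<in> {x \<in> Pi\<^sub>E I B. h x \<noteq> 0}"
        using yI yi U(2,3,5) by (auto simp: B_def h_def PiE_iff)
      moreover have "{x \<in> Pi\<^sub>E I B. h x \<noteq> 0} \<subseteq> points ?Y - e ` points X"
      proof -
        have "h (e p) = 0" if "p \<in> points X" for p
          using that None i(1) i0 by (simp add: h_def coordinate_map_apply)
        moreover have "Pi\<^sub>E I B \<subseteq> points ?Y"
          unfolding points_power_space using openin_subset[OF B] by (rule PiE_mono)
        ultimately show ?thesis by auto
      qed
      ultimately show ?thesis by blast
    next
      case (Some c)
      have ne: "y i \<noteq> c" using i yi[OF i0(1)] Some by (simp add: coordinate_map_apply)
      have "c \<in> points X" using w i(1) Some by force
      then obtain U f where U: "openin (zariski X) U" "y i \<in> U" "c \<in> U" "f \<in> regular X U" "f (y i) \<noteq> f c"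
        using points_separated[OF yi[OF i(1)] _ ne] by blast
      define B where "B j = (if j = i then U else points X)" for j
      define h where "h x = f (x i) + - f c" for x :: "'i \<Rightarrow> 'a"
      have B: "openin (zariski X) (B j)" for j using U(1) by (simp add: B_def)
      have "box_function X I B h"
        unfolding h_def using U(4) i(1)
        by (intro box_function.intros) (auto simp: B_def)
      then have "openin (zariski ?Y) {x \<in> Pi\<^sub>E I B. h x \<noteq> 0}"
        using B by (intro openin_power_space)
      moreover have "y \<in> {x \<in> Pi\<^sub>E I B. h x \<noteq> 0}"
        using yI yi U(2,5) by (auto simp: B_def h_def PiE_iff)
      moreover have "{x \<in> Pi\<^sub>E I B. h x \<noteq> 0} \<subseteq> points ?Y - e ` points X"
      proof -
        have "h (e p) = 0" if "p \<in> points X" for p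
          using that Some i(1) by (simp add: h_def coordinate_map_apply)
        moreover have "Pi\<^sub>E I B \<subseteq> points ?Y"
          unfolding points_power_space using openin_subset[OF B] by (rule PiE_mono)
        ultimately show ?thesis by auto
      qed
      ultimately show ?thesis by blast
    qed
  qed
  then have "openin (zariski ?Y) (points ?Y - e ` points X)"
    by (subst openin_subopen) blast
  moreover have "e ` points X \<subseteq> points ?Y"
    using coordinate_map_points by (auto simp: points_power_space)
  ultimately show ?thesis by (simp add: closedin_def)
qed

lemma morphism_coordinate_map:
  "morphism X (induced (power_space X I) (e ` points X)) e"
proof -
  let ?Y = "power_space X I" and ?Z = "e ` points X"
  have cont: "continuous_map (zariski X) (zariski (induced ?Y ?Z)) e"
    using continuous_map_coordinate_map by (simp add: induced_def continuous_map_in_subtopology)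
  have "g \<circ> e \<in> regular X {x \<in> points X. e x \<in> V}"
    if V: "openin (zariski (induced ?Y ?Z)) V" and g: "g \<in> regular (induced ?Y ?Z) V" for V g
  proof (rule regular_local)
    fix p assume p: "p \<in> {x \<in> points X. e x \<in> V}"
    let ?U = "{x \<in> points X. e x \<in> V}"
    obtain W g' where W: "openin (zariski ?Y) W" "e p \<in> W" "g' \<in> regular ?Y W" "\<forall>x\<in>W \<inter> V. g x = g' x"
      using g p by (auto simp: induced_def)
    obtain U G H where U: "\<forall>i\<in>I. openin (zariski X) (U i)" "box_function X I U G" "box_function X I U H"
      "e p \<in> Pi\<^sub>E I U" "H (e p) \<noteq> 0" "\<forall>x\<in>W \<inter> Pi\<^sub>E I U. H x \<noteq> 0 \<longrightarrow> g' x = G x / H x"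
      using W(2,3) by (auto simp: power_space_def)
    define N where "N = {q \<in> points X. e q \<in> W} \<inter> {q \<in> points X. e q \<in> Pi\<^sub>E I U \<and> H (e q) \<noteq> 0}"
    have oU: "openin (zariski X) ?U" using cont V by (rule openin_continuous_map_preimage)
    have oN: "openin (zariski X) N"
      unfolding N_def using U(1,3)
      by (intro openin_Int openin_coordinate_map_basic
          openin_continuous_map_preimage[OF continuous_map_coordinate_map W(1)]) auto
    have oNU: "openin (zariski X) (N \<inter> ?U)" using oN oU by blast
    have box: "e q \<in> Pi\<^sub>E I U" if "q \<in> N \<inter> ?U" for q using that by (simp add: N_def)
    have "(\<lambda>q. G (e q) / H (e q)) \<in> regular X (N \<inter> ?U)"
      by (intro regular_divide regular_box_function_coordinate_map[OF _ oNU box] U(2,3)) (auto simp: N_def)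
    moreover have "p \<in> N" using p W(2) U(4,5) by (simp add: N_def)
    moreover have "\<forall>x\<in>N \<inter> ?U. (g \<circ> e) x = G (e x) / H (e x)"
      using W(4) U(6) by (simp add: N_def)
    ultimately show "\<exists>W h. openin (zariski X) W \<and> p \<in> W \<and> h \<in> regular X (W \<inter> ?U) \<and> (\<forall>x\<in>W \<inter> ?U. (g \<circ> e) x = h x)"
      using oN by blast
  qed
  with cont show ?thesis by (simp add: morphism_def)
qed

lemma openin_coordinate_preimage:
  assumes "openin (zariski X) V"
  shows "openin (zariski (power_space X I)) {y \<in> points (power_space X I). y i0 \<in> V}"
    and "g \<in> regular X V \<Longrightarrow>
      (\<lambda>y. g (y i0)) \<in> regular (power_space X I) {y \<in> points (power_space X I). y i0 \<in> V}"
proof -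
  let ?B = "\<lambda>j. if j = i0 then V else points X"
  have eq: "{y \<in> points (power_space X I). y i0 \<in> V} = Pi\<^sub>E I ?B"
  proof (intro equalityI subsetI)
    fix y assume "y \<in> {y \<in> points (power_space X I). y i0 \<in> V}"
    then show "y \<in> Pi\<^sub>E I ?B" by (simp add: points_power_space PiE_iff)
  next
    fix y assume y: "y \<in> Pi\<^sub>E I ?B"
    then have "y \<in> (\<Pi>\<^sub>E i\<in>I. points X)"
      by (rule subsetD[OF PiE_mono, rotated]) (use openin_subset[OF assms] in auto)
    then show "y \<in> {y \<in> points (power_space X I). y i0 \<in> V}"
      using PiE_mem[OF y i0(1)] by (simp add: points_power_space)
  qed
  show "openin (zariski (power_space X I)) {y \<in> points (power_space X I). y i0 \<in> V}"
    unfolding eq by (rule openin_power_space_box) (simp add: assms)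
  assume "g \<in> regular X V"
  then have "box_function X I ?B (\<lambda>y. g (y i0))"
    using i0(1) by (intro box_function.pullback) auto
  then show "(\<lambda>y. g (y i0)) \<in> regular (power_space X I) {y \<in> points (power_space X I). y i0 \<in> V}"
    unfolding eq by (intro regular_power_space) (simp_all add: assms)
qed

lemma morphism_coordinate:
  "morphism (induced (power_space X I) (e ` points X)) X (\<lambda>y. y i0)"
proof -
  let ?Y = "power_space X I" and ?Z = "e ` points X"
  have "continuous_map (zariski ?Y) (zariski X) (\<lambda>y. y i0)"
    using openin_coordinate_preimage(1) i0(1)
    by (auto simp: continuous_map points_power_space PiE_iff)
  then have "continuous_map (zariski (induced ?Y ?Z)) (zariski X) (\<lambda>y. y i0)"
    by (simp add: induced_def continuous_map_from_subtopology)
  moreover have "g \<circ> (\<lambda>y. y i0) \<in> regular (induced ?Y ?Z) {y \<in> points (induced ?Y ?Z). y i0 \<in> V}"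
    if V: "openin (zariski X) V" and g: "g \<in> regular X V" for V g
  proof -
    have "\<exists>W. openin (zariski ?Y) W \<and> y \<in> W \<and>
        (\<exists>h\<in>regular ?Y W. \<forall>x\<in>W \<inter> {y \<in> points (induced ?Y ?Z). y i0 \<in> V}. g (x i0) = h x)"
      if "y \<in> points (induced ?Y ?Z)" "y i0 \<in> V" for y
      using that openin_coordinate_preimage[OF V] g
      by (intro exI[of _ "{y \<in> points ?Y. y i0 \<in> V}"] conjI bexI[of _ "\<lambda>y. g (y i0)"])
        (auto simp: points_induced)
    then show ?thesis by (simp add: induced_def)
  qed
  ultimately show ?thesis by (simp add: morphism_def)
qed

text \<open>
  The inverse is the projection to a coordinate that carries a star.
\<close>

lemma isomorphism_coordinate_map:
  "isomorphism X (induced (power_space X I) (e ` points X)) e"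
  unfolding isomorphism_def
  using morphism_coordinate_map morphism_coordinate coordinate_map_retraction
  by (intro conjI exI[of _ "\<lambda>y. y i0"]) (auto simp: points_induced)

end

lemma closed_embedding_coordinate_map:
  assumes "finite I" "w ` I \<subseteq> insert None (Some ` points X)" "None \<in> w ` I"
  shows "closed_embedding X (power_space X I) (coordinate_map (points X) I w)"
proof -
  obtain i0 where i0: "i0 \<in> I" "w i0 = None" using assms(3) by force
  show ?thesis
    using closedin_coordinate_map_image[OF assms(1,2) i0] isomorphism_coordinate_map[OF assms(1,2) i0]
    by (simp add: closed_embedding_def)
qed

end

text \<open>
  The relation between a point, a rational function and an integer whose unique solution \<open>ord_at\<close>
  selects.  Isomorphisms preserve the relation, hence also the selected value, without any appeal to
  existence or uniqueness.
\<close>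

definition ord_witness :: "'a fspace \<Rightarrow> 'a \<Rightarrow> 'a rat_fun \<Rightarrow> int \<Rightarrow> bool" where
  "ord_witness X p \<phi> k \<longleftrightarrow> (\<exists>U t W u V f.
     uniformizer X p U t \<and>
     openin (zariski X) W \<and> p \<in> W \<and> W \<subseteq> U \<and> u \<in> regular X W \<and> (\<forall>x\<in>W. u x \<noteq> 0) \<and>
     (V, f) \<in> \<phi> \<and> (\<forall>x\<in>V \<inter> W. t x \<noteq> 0 \<longrightarrow> f x = t x powi k * u x))"

lemma morphism_preimage:
  assumes "morphism X Y \<phi>" "openin (zariski Y) V"
  shows "openin (zariski X) {x \<in> points X. \<phi> x \<in> V}"
    and "g \<in> regular Y V \<Longrightarrow> g \<circ> \<phi> \<in> regular X {x \<in> points X. \<phi> x \<in> V}"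
  using assms by (auto simp: morphism_def intro: openin_continuous_map_preimage)

lemma morphism_points: "morphism X Y \<phi> \<Longrightarrow> x \<in> points X \<Longrightarrow> \<phi> x \<in> points Y"
  by (auto simp: morphism_def continuous_map_def)

context
  fixes X :: "'a fspace" and Y :: "'b fspace" and \<phi> \<psi>
  assumes mor: "morphism X Y \<phi>" "morphism Y X \<psi>"
    and inv: "\<And>x. x \<in> points X \<Longrightarrow> \<psi> (\<phi> x) = x" "\<And>y. y \<in> points Y \<Longrightarrow> \<phi> (\<psi> y) = y"
begin

lemma uniformizer_pullback:
  assumes p: "p \<in> points X" and t: "uniformizer Y (\<phi> p) U t"
  shows "uniformizer X p {x \<in> points X. \<phi> x \<in> U} (t \<circ> \<phi>)"
proof -
  have t1: "openin (zariski Y) U" "\<phi> p \<in> U" "t \<in> regular Y U" "t (\<phi> p) = 0"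
    and t2: "\<And>V g. openin (zariski Y) V \<Longrightarrow> \<phi> p \<in> V \<Longrightarrow> g \<in> regular Y V \<Longrightarrow> g (\<phi> p) = 0 \<Longrightarrow>
        \<exists>W h. openin (zariski Y) W \<and> \<phi> p \<in> W \<and> W \<subseteq> U \<inter> V \<and> h \<in> regular Y W \<and> (\<forall>x\<in>W. g x = t x * h x)"
    using t unfolding uniformizer_def by blast+
  have "\<exists>W h. openin (zariski X) W \<and> p \<in> W \<and> W \<subseteq> {x \<in> points X. \<phi> x \<in> U} \<inter> V \<and> h \<in> regular X W \<and>
      (\<forall>x\<in>W. g x = (t \<circ> \<phi>) x * h x)"
    if V: "openin (zariski X) V" "p \<in> V" "g \<in> regular X V" "g p = 0" for V g
  proof -
    obtain W h where W: "openin (zariski Y) W" "\<phi> p \<in> W" "W \<subseteq> U \<inter> {y \<in> points Y. \<psi> y \<in> V}" "h \<in> regular Y W"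
      "\<forall>y\<in>W. (g \<circ> \<psi>) y = t y * h y"
      using t2[of "{y \<in> points Y. \<psi> y \<in> V}" "g \<circ> \<psi>"] V p inv(1) morphism_points[OF mor(1) p]
        morphism_preimage[OF mor(2) V(1)] by auto
    show ?thesis
    proof (intro exI conjI)
      show "openin (zariski X) {x \<in> points X. \<phi> x \<in> W}" "h \<circ> \<phi> \<in> regular X {x \<in> points X. \<phi> x \<in> W}"
        using morphism_preimage[OF mor(1) W(1)] W(4) by auto
      show "p \<in> {x \<in> points X. \<phi> x \<in> W}" using p W(2) by simp
      show "{x \<in> points X. \<phi> x \<in> W} \<subseteq> {x \<in> points X. \<phi> x \<in> U} \<inter> V" using W(3) inv(1) by force
      show "\<forall>x\<in>{x \<in> points X. \<phi> x \<in> W}. g x = (t \<circ> \<phi>) x * (h \<circ> \<phi>) x"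
      proof
        fix x assume "x \<in> {x \<in> points X. \<phi> x \<in> W}"
        then show "g x = (t \<circ> \<phi>) x * (h \<circ> \<phi>) x"
          using bspec[OF W(5), of "\<phi> x"] inv(1)[of x] by simp
      qed
    qed
  qed
  then show ?thesis
    unfolding uniformizer_def using t1 p morphism_preimage[OF mor(1) t1(1)] by simp
qed

lemma ord_witness_pullback:
  assumes p: "p \<in> points X" and w: "ord_witness Y (\<phi> p) r k"
    and r: "\<And>V f. (V, f) \<in> r \<Longrightarrow> ({x \<in> points X. \<phi> x \<in> V}, f \<circ> \<phi>) \<in> s"
  shows "ord_witness X p s k"
proof -
  obtain U t W u V f where *: "uniformizer Y (\<phi> p) U t" "openin (zariski Y) W" "\<phi> p \<in> W" "W \<subseteq> U"
    "u \<in> regular Y W" "\<forall>x\<in>W. u x \<noteq> 0" "(V, f) \<in> r" "\<forall>x\<in>V \<inter> W. t x \<noteq> 0 \<longrightarrow> f x = t x powi k * u x"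
    using w unfolding ord_witness_def by (elim exE conjE)
  show ?thesis
    unfolding ord_witness_def
  proof (intro exI conjI)
    show "uniformizer X p {x \<in> points X. \<phi> x \<in> U} (t \<circ> \<phi>)" using p *(1) by (rule uniformizer_pullback)
    show "openin (zariski X) {x \<in> points X. \<phi> x \<in> W}" "u \<circ> \<phi> \<in> regular X {x \<in> points X. \<phi> x \<in> W}"
      using morphism_preimage[OF mor(1) *(2)] *(5) by auto
    show "({x \<in> points X. \<phi> x \<in> V}, f \<circ> \<phi>) \<in> s" using r *(7) by blast
    show "p \<in> {x \<in> points X. \<phi> x \<in> W}" "{x \<in> points X. \<phi> x \<in> W} \<subseteq> {x \<in> points X. \<phi> x \<in> U}"
      "\<forall>x\<in>{x \<in> points X. \<phi> x \<in> W}. (u \<circ> \<phi>) x \<noteq> 0"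
      using p *(3,4,6) by auto
    show "\<forall>x\<in>{x \<in> points X. \<phi> x \<in> V} \<inter> {x \<in> points X. \<phi> x \<in> W}.
        (t \<circ> \<phi>) x \<noteq> 0 \<longrightarrow> (f \<circ> \<phi>) x = (t \<circ> \<phi>) x powi k * (u \<circ> \<phi>) x"
      using *(8) by simp
  qed
qed

end

text \<open>
  Only the values on the open set matter for membership in the class.  This is needed because
  transporting a representative back and forth changes its values outside of that set.
\<close>

lemma function_field_change_rep:
  assumes "r \<in> function_field X" "(V, f) \<in> r" "g \<in> regular X V" "\<And>x. x \<in> V \<Longrightarrow> g x = f x"
  shows "(V, g) \<in> r"
  using assms by (fastforce simp: function_field_def quotient_def rat_rel_def rat_reps_def)

lemma function_field_reps: "r \<in> function_field X \<Longrightarrow> (V, f) \<in> r \<Longrightarrow> (V, f) \<in> rat_reps X"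
  by (auto simp: function_field_def quotient_def rat_rel_def)

text \<open>
  An isomorphism and its inverse carry order witnesses in both directions.
\<close>

lemma divisor_of_transport_rat:
  assumes emb: "closed_embedding X Y e" and r: "r \<in> function_field X" and p: "p \<in> points X"
  shows "divisor_of (induced Y (e ` points X)) (transport_rat X Y e r) (e p) = divisor_of X r p"
proof -
  let ?Z = "induced Y (e ` points X)" and ?s = "transport_rat X Y e r"
  obtain \<psi> where \<psi>: "morphism X ?Z e" "morphism ?Z X \<psi>" "\<And>x. x \<in> points X \<Longrightarrow> \<psi> (e x) = x"
    "\<And>y. y \<in> points ?Z \<Longrightarrow> e (\<psi> y) = y"
    using emb unfolding closed_embedding_def isomorphism_def by blast
  have s: "({y \<in> points ?Z. \<psi> y \<in> V}, f \<circ> \<psi>) \<in> ?s" if Vf: "(V, f) \<in> r" for V f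
  proof -
    have V: "openin (zariski X) V" "V \<noteq> {}" "f \<in> regular X V"
      using function_field_reps[OF r Vf] by (auto simp: rat_reps_def)
    let ?V = "{y \<in> points ?Z. \<psi> y \<in> V}"
    have V': "openin (zariski ?Z) ?V" "f \<circ> \<psi> \<in> regular ?Z ?V"
      using morphism_preimage[OF \<psi>(2) V(1)] V(3) by auto
    have eq: "{x \<in> points X. e x \<in> ?V} = V"
      using openin_subset[OF V(1)] \<psi>(3) morphism_points[OF \<psi>(1)] by auto
    have "?V \<noteq> {}" using eq V(2) by blast
    moreover have "f \<circ> \<psi> \<circ> e \<in> regular X V"
      using morphism_preimage(2)[OF \<psi>(1) V'] unfolding eq .
    then have "(V, f \<circ> \<psi> \<circ> e) \<in> r"
      by (rule function_field_change_rep[OF r Vf]) (use openin_subset[OF V(1)] \<psi>(3) in auto)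
    ultimately show ?thesis
      unfolding transport_rat_def using V' eq by (simp add: rat_reps_def)
  qed
  have "ord_witness ?Z (e p) ?s k \<longleftrightarrow> ord_witness X p r k" for k
  proof
    assume w: "ord_witness ?Z (e p) ?s k"
    show "ord_witness X p r k"
      by (rule ord_witness_pullback[OF \<psi>(1,2) _ _ p w]) (auto simp: \<psi>(3,4) transport_rat_def)
  next
    assume "ord_witness X p r k"
    then have w: "ord_witness X (\<psi> (e p)) r k" using \<psi>(3) p by simp
    show "ord_witness ?Z (e p) ?s k"
      by (rule ord_witness_pullback[OF \<psi>(2,1) _ _ morphism_points[OF \<psi>(1) p] w])
        (use \<psi>(3,4) s in auto)
  qed
  moreover have "e p \<in> points ?Z" using morphism_points[OF \<psi>(1) p] .
  ultimately show ?thesis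
    using p by (simp add: divisor_of_def ord_at_def ord_witness_def)
qed

section \<open>Invariant cycles\<close>


text \<open>
  The sum in \<open>boundary\<close> runs over the support, which is not additive; over a common finite superset
  linearity is visible.
\<close>

lemma boundary_superset:
  assumes "finite K" "Poly_Mapping.keys z \<subseteq> K"
  shows "boundary Y z x = (\<Sum>(Z, g)\<in>K. Poly_Mapping.lookup z (Z, g) * of_int (divisor_of (induced Y Z) g x))"
  unfolding boundary_def using assms
  by (intro sum.mono_neutral_left) (auto simp: in_keys_iff)

lemma boundary_zero: "boundary Y 0 x = 0"
  by (simp add: boundary_def)

lemma boundary_add: "boundary Y (z + z') x = boundary Y z x + boundary Y z' x"
proof -
  let ?K = "Poly_Mapping.keys z \<union> Poly_Mapping.keys z'"
  have fin: "finite ?K" by simp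
  have "Poly_Mapping.keys (z + z') \<subseteq> ?K" by (rule keys_add)
  then show ?thesis
    by (simp add: boundary_superset[OF fin] lookup_add algebra_simps split_def sum.distrib)
qed

lemma boundary_rat_scale: "boundary Y (rat_scale q z) x = q * boundary Y z x"
proof -
  have "Poly_Mapping.keys (rat_scale q z) \<subseteq> Poly_Mapping.keys z"
    by (auto simp: in_keys_iff)
  then show ?thesis
    by (simp add: boundary_superset[of "Poly_Mapping.keys z"] sum_distrib_left split_def mult.assoc)
qed

lemma boundary_single:
  "boundary Y (Poly_Mapping.single (Z, g) c) x = c * of_int (divisor_of (induced Y Z) g x)"
  by (subst boundary_superset[of "{(Z, g)}"]) auto

lemma boundary_embedding_sum:
  "boundary Y (embedding_sum C n f E m) x = (\<Sum>e\<in>E. m e * of_int (divisor_of (induced Y (e ` C))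
     (transport_rat (proj_variety C) (curve_power C n) e f) x))"
  unfolding embedding_sum_def
  by (induction E rule: infinite_finite_induct) (simp_all add: boundary_zero boundary_add boundary_single)

lemma keys_embedding_sum:
  "Poly_Mapping.keys (embedding_sum C n f E m)
     \<subseteq> (\<lambda>e. (e ` C, transport_rat (proj_variety C) (curve_power C n) e f)) ` E"
  unfolding embedding_sum_def by (rule order_trans[OF keys_sum]) auto

lemma embedding_sum_add:
  "embedding_sum C n f E m + embedding_sum C n f E m' = embedding_sum C n f E (\<lambda>e. m e + m' e)"
  by (simp add: embedding_sum_def single_add sum.distrib)

lemma rat_scale_single: "rat_scale q (Poly_Mapping.single k c) = Poly_Mapping.single k (q * c)"
  by (rule poly_mapping_eqI) (simp add: lookup_single when_def)

lemma rat_scale_embedding_sum: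
  "rat_scale q (embedding_sum C n f E m) = embedding_sum C n f E (\<lambda>e. q * m e)"
proof -
  interpret vector_space rat_scale by (rule vector_space_rat_scale)
  show ?thesis by (simp add: embedding_sum_def scale_sum_right rat_scale_single)
qed

lemma subspace_invariant_cycles: "module.subspace rat_scale (invariant_cycles C n a b f)"
proof -
  interpret vector_space rat_scale by (rule vector_space_rat_scale)
  define E where "E = coord_embeddings C n (a ` {1..n} \<union> b ` {1..n})"
  define cyc where "cyc m \<longleftrightarrow> invariant_coefficients C n a b E m \<and>
      higher_chow_cycle (curve_power C n) (embedding_sum C n f E m)" for m
  have eq: "invariant_cycles C n a b f = {embedding_sum C n f E m | m. cyc m}"
    by (simp add: invariant_cycles_def E_def cyc_def)
  have zero: "embedding_sum C n f E (\<lambda>_. 0) = 0"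
    by (simp add: embedding_sum_def)
  have c0: "cyc (\<lambda>_. 0)"
    by (simp add: cyc_def invariant_coefficients_def higher_chow_cycle_def zero boundary_zero)
  have cadd: "cyc (\<lambda>e. m e + m' e)" if "cyc m" "cyc m'" for m m'
    using that by (simp add: cyc_def invariant_coefficients_def higher_chow_cycle_def boundary_add
      flip: embedding_sum_add)
  have cscale: "cyc (\<lambda>e. q * m e)" if "cyc m" for q m
    using that by (simp add: cyc_def invariant_coefficients_def higher_chow_cycle_def boundary_rat_scale
      flip: rat_scale_embedding_sum)
  show ?thesis
    unfolding subspace_def eq
  proof (intro conjI ballI allI)
    show "0 \<in> {embedding_sum C n f E m | m. cyc m}" using c0 zero by force
  next
    fix z z' assume "z \<in> {embedding_sum C n f E m | m. cyc m}" "z' \<in> {embedding_sum C n f E m | m. cyc m}"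
    then show "z + z' \<in> {embedding_sum C n f E m | m. cyc m}" using cadd embedding_sum_add by blast
  next
    fix q z assume "z \<in> {embedding_sum C n f E m | m. cyc m}"
    then show "rat_scale q z \<in> {embedding_sum C n f E m | m. cyc m}" using cscale rat_scale_embedding_sum by blast
  qed
qed

text \<open>
  The common finite support makes the space finite-dimensional.  This matters because the dimension of
  an infinite-dimensional space is 0 by convention.
\<close>

lemma dim_pos_rat_scale:
  fixes V :: "('k \<Rightarrow>\<^sub>0 rat) set"
  assumes fin: "finite K" and V: "\<And>z. z \<in> V \<Longrightarrow> Poly_Mapping.keys z \<subseteq> K" and z: "z \<in> V" "z \<noteq> 0"
  shows "vector_space.dim rat_scale V > 0"
proof -
  interpret vector_space rat_scale by (rule vector_space_rat_scale)
  let ?e = "\<lambda>k. Poly_Mapping.single k (1::rat)"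
  have span: "z \<in> span (?e ` K)" if "z \<in> V" for z
  proof -
    have "z = (\<Sum>k\<in>K. rat_scale (Poly_Mapping.lookup z k) (?e k))"
    proof (rule poly_mapping_eqI)
      fix k
      have "Poly_Mapping.lookup z k = (\<Sum>j\<in>K. if j = k then Poly_Mapping.lookup z j else 0)"
        using fin V[OF that] by (auto simp: in_keys_iff)
      also have "\<dots> = (\<Sum>j\<in>K. Poly_Mapping.lookup (rat_scale (Poly_Mapping.lookup z j) (?e j)) k)"
        by (rule sum.cong) (auto simp: lookup_single when_def)
      finally show "Poly_Mapping.lookup z k =
          Poly_Mapping.lookup (\<Sum>j\<in>K. rat_scale (Poly_Mapping.lookup z j) (?e j)) k"
        by (simp add: lookup_sum)
    qed
    also have "\<dots> \<in> span (?e ` K)" by (intro span_sum span_scale span_base) auto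
    finally show ?thesis .
  qed
  obtain B where B: "B \<subseteq> V" "independent B" "V \<subseteq> span B" "card B = dim V"
    using basis_exists by blast
  have "finite B"
    using independent_span_bound[of "?e ` K" B] fin B(1,2) span by auto
  moreover have "B \<noteq> {}"
    using B(3) z by auto
  ultimately show ?thesis using B(4) by (metis card_gt_0_iff)
qed

text \<open>
  Recovers the word of a coordinate embedding.  A constant coordinate may be read off at any point,
  provided that there are two points, so that it is not at the same time the identity.
\<close>

definition word_of :: "'a set \<Rightarrow> ('a \<Rightarrow> 'i \<Rightarrow> 'a) \<Rightarrow> 'i \<Rightarrow> 'a option" where
  "word_of P e j = (if \<forall>p\<in>P. e p j = p then None else Some (e (SOME p. p \<in> P) j))"

lemma coordinate_map_cong:
  "(\<And>i. i \<in> I \<Longrightarrow> w i = w' i) \<Longrightarrow> coordinate_map P I w = coordinate_map P I w'"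
  by (auto simp: coordinate_map_def restrict_def fun_eq_iff)

context
  fixes C :: "'n::finite proj set" and n :: nat and S :: "'n proj set" and p q
  assumes SC: "S \<subseteq> C" and pq: "p \<in> C" "q \<in> C" "p \<noteq> q"
begin

lemma word_of_coordinate_map:
  assumes "j \<in> I"
  shows "word_of C (coordinate_map C I w) j = w j"
proof -
  have "(SOME p. p \<in> C) \<in> C" using pq(1) by (rule someI)
  moreover have "\<exists>x\<in>C. c \<noteq> x" for c using pq by metis
  ultimately show ?thesis
    using assms by (auto simp: word_of_def coordinate_map_def split: option.splits)
qed

lemma coordinate_map_in_coord_embeddings:
  assumes w: "w ` {..n} \<subseteq> insert None (Some ` S)" "None \<in> w ` {..n}"
  shows "coordinate_map C {..n} w \<in> coord_embeddings C n S"
proof -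
  interpret function_space "proj_variety C" by (rule function_space_proj_variety)
  let ?e = "coordinate_map C {..n} w"
  have emb: "closed_embedding (proj_variety C) (curve_power C n) ?e"
  proof -
    have "w ` {..n} \<subseteq> insert None (Some ` points (proj_variety C))" using w(1) SC by auto
    from closed_embedding_coordinate_map[OF finite_atMost this w(2)] show ?thesis by simp
  qed
  have letter: "w j = None \<or> (\<exists>c\<in>S. w j = Some c)" if "j \<le> n" for j
    using w(1) that by blast
  have "?e \<in> C \<rightarrow>\<^sub>E points (curve_power C n)"
    using letter SC by (fastforce simp: coordinate_map_def points_power_space PiE_iff split: option.splits)
  moreover have "(\<forall>p\<in>C. ?e p j = p) \<or> (\<exists>c\<in>S. \<forall>p\<in>C. ?e p j = c)" if "j \<le> n" for j
    using letter[OF that] that by (auto simp: coordinate_map_def)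
  ultimately show ?thesis using emb by (simp add: coord_embeddings_def)
qed

text \<open>
  A star is present because an embedding is injective and there are two different points.
\<close>

lemma word_of_coord_embedding:
  assumes e: "e \<in> coord_embeddings C n S"
  shows "coordinate_map C {..n} (word_of C e) = e"
    and "word_of C e ` {..n} \<subseteq> insert None (Some ` S)" and "None \<in> word_of C e ` {..n}"
proof -
  have e1: "e \<in> C \<rightarrow>\<^sub>E points (curve_power C n)" and
    e2: "\<And>j. j \<le> n \<Longrightarrow> (\<forall>p\<in>C. e p j = p) \<or> (\<exists>c\<in>S. \<forall>p\<in>C. e p j = c)"
    and emb: "closed_embedding (proj_variety C) (curve_power C n) e"
    using e by (auto simp: coord_embeddings_def)
  have some: "(SOME p. p \<in> C) \<in> C" using pq(1) by (rule someI)
  have None: "e p j = p" if "word_of C e j = None" "p \<in> C" for p j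
    using that by (auto simp: word_of_def split: if_splits)
  have Some: "c \<in> S \<and> (\<forall>p\<in>C. e p j = c)" if "word_of C e j = Some c" "j \<le> n" for c j
    using e2[OF that(2)] that(1) some by (auto simp: word_of_def split: if_splits)
  have ePiE: "e r \<in> (\<Pi>\<^sub>E i\<in>{..n}. C)" if "r \<in> C" for r
    using e1 that by (auto simp: points_power_space)
  show *: "coordinate_map C {..n} (word_of C e) = e"
  proof
    fix r
    show "coordinate_map C {..n} (word_of C e) r = e r"
    proof (cases "r \<in> C")
      case True
      have "coordinate_map C {..n} (word_of C e) r j = e r j" for j
        using True None[OF _ True, of j] Some[of j] PiE_arb[OF ePiE[OF True], of j]
        by (cases "j \<le> n"; cases "word_of C e j") (auto simp: coordinate_map_def)
      then show ?thesis by blast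
    next
      case False
      then show ?thesis using e1 by (auto simp: coordinate_map_def)
    qed
  qed
  show "word_of C e ` {..n} \<subseteq> insert None (Some ` S)"
  proof
    fix l assume "l \<in> word_of C e ` {..n}"
    then show "l \<in> insert None (Some ` S)" using Some by (cases l) fastforce+
  qed
  show "None \<in> word_of C e ` {..n}"
  proof (rule ccontr)
    assume nn: "None \<notin> word_of C e ` {..n}"
    have "e p j = e q j" if "j \<in> {..n}" for j
    proof -
      have "word_of C e j \<noteq> None" using nn that by (metis imageI)
      then obtain c where "word_of C e j = Some c" by blast
      then show ?thesis using Some[of j c] that pq by simp
    qed
    then have "e p = e q"
      by (intro PiE_ext[OF ePiE[OF pq(1)] ePiE[OF pq(2)]]) simp
    moreover obtain \<psi> where "\<forall>x\<in>C. \<psi> (e x) = x"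
      using emb by (auto simp: closed_embedding_def isomorphism_def)
    then have "\<psi> (e p) = p" "\<psi> (e q) = q" using pq by auto
    ultimately show False using pq(3) by simp
  qed
qed

lemma finite_coord_embeddings:
  assumes "finite S"
  shows "finite (coord_embeddings C n S)"
proof (rule finite_subset)
  show "coord_embeddings C n S \<subseteq> coordinate_map C {..n} ` ({..n} \<rightarrow>\<^sub>E insert None (Some ` S))"
  proof
    fix e assume e: "e \<in> coord_embeddings C n S"
    have "e = coordinate_map C {..n} (restrict (word_of C e) {..n})"
      using word_of_coord_embedding(1)[OF e] coordinate_map_cong[of "{..n}" "restrict (word_of C e) {..n}" "word_of C e"]
      by simp
    moreover have "restrict (word_of C e) {..n} \<in> {..n} \<rightarrow>\<^sub>E insert None (Some ` S)"
      using word_of_coord_embedding(2)[OF e] by auto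
    ultimately show "e \<in> coordinate_map C {..n} ` ({..n} \<rightarrow>\<^sub>E insert None (Some ` S))" by blast
  qed
qed (use assms in \<open>auto intro!: finite_PiE\<close>)

text \<open>
  The projections of the image to the factors are all of \<open>C\<close> for a star and a single point for a
  constant letter, so the image determines the word.
\<close>

lemma inj_on_image_coord_embeddings: "inj_on (\<lambda>e. e ` C) (coord_embeddings C n S)"
proof (rule inj_onI)
  fix e e' assume e: "e \<in> coord_embeddings C n S" and e': "e' \<in> coord_embeddings C n S" and eq: "e ` C = e' ` C"
  have letter: "(\<lambda>y. y j) ` e ` C = (case word_of C e j of None \<Rightarrow> C | Some c \<Rightarrow> {c})"
    if "e \<in> coord_embeddings C n S" "j \<le> n" for e j
  proof -
    have "e r j = (case word_of C e j of None \<Rightarrow> r | Some c \<Rightarrow> c)" if "r \<in> C" for r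
      using that \<open>j \<le> n\<close> arg_cong[OF word_of_coord_embedding(1)[OF \<open>e \<in> _\<close>], of "\<lambda>e. e r j"]
      by (simp add: coordinate_map_def)
    then show ?thesis using pq(1) by (force simp: image_image split: option.splits)
  qed
  have "word_of C e j = word_of C e' j" if "j \<in> {..n}" for j
  proof -
    have "(case word_of C e j of None \<Rightarrow> C | Some c \<Rightarrow> {c}) = (case word_of C e' j of None \<Rightarrow> C | Some c \<Rightarrow> {c})"
      using letter[OF e] letter[OF e'] that eq by simp
    then show ?thesis using pq by (auto split: option.splits)
  qed
  then have "coordinate_map C {..n} (word_of C e) = coordinate_map C {..n} (word_of C e')"
    by (rule coordinate_map_cong)
  then show "e = e'" using word_of_coord_embedding(1) e e' by simp
qed

lemma word_of_permute_factors: "word_of C (permute_factors C \<sigma> e) = word_of C e \<circ> inv_into UNIV \<sigma>"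
proof -
  have "(SOME p. p \<in> C) \<in> C" using pq(1) by (rule someI)
  then show ?thesis by (auto simp: word_of_def permute_factors_def fun_eq_iff)
qed

lemma word_of_relabel:
  assumes e: "e \<in> coord_embeddings C n S" and j: "j \<le> n"
  shows "word_of C (relabel C n \<tau> e) j = map_option \<tau> (word_of C e j)"
proof -
  have some: "(SOME p. p \<in> C) \<in> C" using pq(1) by (rule someI)
  have "(\<forall>p\<in>C. e p j = p) \<or> (\<exists>c\<in>S. \<forall>p\<in>C. e p j = c)"
    using e j by (auto simp: coord_embeddings_def)
  then show ?thesis
  proof
    assume "\<forall>p\<in>C. e p j = p"
    then show ?thesis using j by (simp add: word_of_def relabel_def)
  next
    assume "\<exists>c\<in>S. \<forall>p\<in>C. e p j = c"
    then obtain c where c: "\<forall>p\<in>C. e p j = c" by blast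
    then have "\<not> (\<forall>p\<in>C. e p j = p)" using pq by metis
    moreover from this have r: "relabel C n \<tau> e r j = \<tau> c" if "r \<in> C" for r
      using c j that by (auto simp: relabel_def)
    then have "\<not> (\<forall>p\<in>C. relabel C n \<tau> e p j = p)" using pq by metis
    ultimately show ?thesis using r c some by (simp add: word_of_def)
  qed
qed

text \<open>
  The embeddings that map \<open>p0\<close> to \<open>x\<close> correspond to the nonempty sets of positions where \<open>x\<close> equals \<open>p0\<close>,
  via the set of stars.
\<close>

lemma sum_embeddings_through_point:
  assumes p0: "p0 \<in> S" and x: "x \<in> (\<Pi>\<^sub>E i\<in>{..n}. S)"
    and loc: "\<And>w w'. (\<forall>j\<le>n. w j = w' j) \<Longrightarrow> \<mu> w = (\<mu> w' :: rat)"
  shows "(\<Sum>e | e \<in> coord_embeddings C n S \<and> e p0 = x. \<mu> (word_of C e))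
    = (\<Sum>J | J \<subseteq> {..n} \<and> x ` J = {p0}. \<mu> (starred J x))"
proof -
  have p0C: "p0 \<in> C" using p0 SC by blast
  have starJ: "starred {j \<in> {..n}. word_of C e j = None} x j = word_of C e j"
    if e: "e \<in> coord_embeddings C n S" "e p0 = x" and j: "j \<le> n" for e j
  proof -
    have "x j = (case word_of C e j of None \<Rightarrow> p0 | Some c \<Rightarrow> c)"
      using p0C j e(2) arg_cong[OF word_of_coord_embedding(1)[OF e(1)], of "\<lambda>e. e p0 j"]
      by (simp add: coordinate_map_def)
    then show ?thesis using j by (auto simp: starred_def split: option.splits)
  qed
  show ?thesis
  proof (rule sum.reindex_bij_witness[where i = "\<lambda>J. coordinate_map C {..n} (starred J x)"
        and j = "\<lambda>e. {j \<in> {..n}. word_of C e j = None}"])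
    fix e assume "e \<in> {e. e \<in> coord_embeddings C n S \<and> e p0 = x}"
    then have e: "e \<in> coord_embeddings C n S" "e p0 = x" by auto
    let ?J = "{j \<in> {..n}. word_of C e j = None}"
    show "coordinate_map C {..n} (starred ?J x) = e"
      using coordinate_map_cong[of "{..n}" "starred ?J x" "word_of C e"] starJ[OF e]
        word_of_coord_embedding(1)[OF e(1)] by simp
    have "x j = p0" if "j \<in> ?J" for j
      using that e(2) p0C by (auto simp: word_of_def split: if_splits)
    moreover have "?J \<noteq> {}" using word_of_coord_embedding(3)[OF e(1)] by auto
    ultimately show "?J \<in> {J. J \<subseteq> {..n} \<and> x ` J = {p0}}" by auto
    show "\<mu> (starred ?J x) = \<mu> (word_of C e)"
      by (rule loc) (use starJ[OF e] in auto)
  next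
    fix J assume "J \<in> {J. J \<subseteq> {..n} \<and> x ` J = {p0}}"
    then have J: "J \<subseteq> {..n}" "x ` J = {p0}" by auto
    let ?e = "coordinate_map C {..n} (starred J x)"
    have "J \<noteq> {}" using J(2) by auto
    have "starred J x ` {..n} \<subseteq> insert None (Some ` S)"
      using PiE_mem[OF x] by (auto simp: starred_def)
    moreover have "None \<in> starred J x ` {..n}"
      using J(1) \<open>J \<noteq> {}\<close> by (force simp: starred_def image_iff)
    moreover have "?e p0 = x"
    proof
      fix j
      show "?e p0 j = x j"
        using J(2) p0C PiE_arb[OF x, of j] by (cases "j \<le> n") (auto simp: coordinate_map_def starred_def)
    qed
    ultimately show "?e \<in> {e. e \<in> coord_embeddings C n S \<and> e p0 = x}"
      using coordinate_map_in_coord_embeddings by simp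
    have "{j \<in> {..n}. word_of C ?e j = None} = {j \<in> {..n}. j \<in> J}"
      by (intro Collect_cong conj_cong refl) (simp add: word_of_coordinate_map starred_def)
    then show "{j \<in> {..n}. word_of C ?e j = None} = J"
      using J(1) by blast
  qed
qed

lemma sum_embeddings_eq_word_boundary:
  assumes fin: "finite S" and x: "x \<in> (\<Pi>\<^sub>E i\<in>{..n}. S)"
    and loc: "\<And>w w'. (\<forall>j\<le>n. w j = w' j) \<Longrightarrow> \<mu> w = (\<mu> w' :: rat)"
  shows "(\<Sum>e\<in>coord_embeddings C n S. \<mu> (word_of C e) * (\<Sum>r\<in>S. if e r = x then \<epsilon> r else 0))
    = word_boundary S \<epsilon> n \<mu> x"
proof -
  let ?E = "coord_embeddings C n S"
  have finE: "finite ?E" using fin by (rule finite_coord_embeddings)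
  have "(\<Sum>e\<in>?E. \<mu> (word_of C e) * (\<Sum>r\<in>S. if e r = x then \<epsilon> r else 0))
      = (\<Sum>r\<in>S. \<Sum>e\<in>?E. if e r = x then \<epsilon> r * \<mu> (word_of C e) else 0)"
    by (subst sum.swap) (auto simp: sum_distrib_left intro!: sum.cong)
  also have "\<dots> = (\<Sum>r\<in>S. \<epsilon> r * (\<Sum>e | e \<in> ?E \<and> e r = x. \<mu> (word_of C e)))"
    using finE by (auto simp: sum.inter_filter sum_distrib_left intro!: sum.cong)
  also have "\<dots> = (\<Sum>r\<in>S. \<epsilon> r * (\<Sum>J | J \<in> Pow {..n} \<and> x ` J = {r}. \<mu> (starred J x)))"
    by (intro sum.cong refl arg_cong2[where f = "(*)"], unfold Pow_iff,
        rule sum_embeddings_through_point[OF _ x, where \<mu> = \<mu>]) (simp_all add: loc)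
  also have "\<dots> = (\<Sum>r\<in>S. \<Sum>J\<in>Pow {..n}. if x ` J = {r} then \<epsilon> r * \<mu> (starred J x) else 0)"
    by (simp only: sum.inter_filter sum_distrib_left finite_Pow_iff finite_atMost)
      (simp add: if_distrib cong: if_cong)
  also have "\<dots> = word_boundary S \<epsilon> n \<mu> x"
    unfolding word_boundary_def by (rule sum.swap)
  finally show ?thesis .
qed

end

lemma permute_family_apply:
  "inj_on a I \<Longrightarrow> i \<in> I \<Longrightarrow> permute_family I a \<sigma> (a i) = a (\<sigma> i)"
  "c \<notin> a ` I \<Longrightarrow> permute_family I a \<sigma> c = c"
  by (simp_all add: permute_family_def)

lemma switch_families_apply:
  "inj_on a I \<Longrightarrow> i \<in> I \<Longrightarrow> switch_families I a b (a i) = b i"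
  "inj_on b I \<Longrightarrow> a ` I \<inter> b ` I = {} \<Longrightarrow> i \<in> I \<Longrightarrow> switch_families I a b (b i) = a i"
  by (auto simp: switch_families_def)

lemma permute_family_image_iff:
  assumes "inj_on a I" "\<sigma> permutes I"
  shows "permute_family I a \<sigma> c \<in> a ` I \<longleftrightarrow> c \<in> a ` I"
  using assms permutes_in_image[OF assms(2)]
  by (cases "c \<in> a ` I") (auto simp: permute_family_apply)

lemma inj_permute_family:
  assumes "inj_on a I" "\<sigma> permutes I"
  shows "inj (permute_family I a \<sigma>)"
proof (rule injI)
  fix c d assume eq: "permute_family I a \<sigma> c = permute_family I a \<sigma> d"
  show "c = d"
  proof (cases "c \<in> a ` I")
    case True
    then have "d \<in> a ` I" using eq permute_family_image_iff[OF assms] by metis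
    then show ?thesis
      using True eq assms permutes_in_image[OF assms(2)] permutes_inj[OF assms(2)]
      by (auto simp: permute_family_apply inj_on_eq_iff)
  next
    case False
    then have "d \<notin> a ` I" using eq permute_family_image_iff[OF assms] by metis
    then show ?thesis using False eq by (simp add: permute_family_apply)
  qed
qed

lemma inj_on_switch_families:
  assumes "inj_on a I" "inj_on b I" "a ` I \<inter> b ` I = {}"
  shows "inj_on (switch_families I a b) (a ` I \<union> b ` I)"
proof -
  have "a i \<noteq> b j" if "i \<in> I" "j \<in> I" for i j
    using assms(3) that by blast
  then show ?thesis
    using assms by (intro inj_onI) (auto simp: switch_families_apply inj_on_eq_iff, metis+)
qed

lemma lookup_sum_frag_of:
  assumes "finite I" "inj_on a I"
  shows "Poly_Mapping.lookup (\<Sum>i\<in>I. frag_of (a i)) p = of_bool (p \<in> a ` I)"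
proof -
  have "Poly_Mapping.lookup (\<Sum>i\<in>I. frag_of (a i)) p = (\<Sum>c\<in>a ` I. Poly_Mapping.lookup (frag_of c) p)"
    by (simp add: lookup_sum sum.reindex[OF assms(2)])
  also have "\<dots> = (\<Sum>c\<in>a ` I. if c = p then 1 else 0)"
    by (rule sum.cong) (auto simp: lookup_single when_def)
  finally show ?thesis using assms(1) by simp
qed


theorem proposition4p1:
  fixes C :: "'n::finite proj set"
    and n :: nat
    and a b :: "nat \<Rightarrow> 'n proj"
    and D :: "'n proj \<Rightarrow>\<^sub>0 int"
    and f :: "'n proj rat_fun"
  assumes "smooth_projective_curve C"
    and "n > 0"
    and "a ` {1..n} \<subseteq> C" and "b ` {1..n} \<subseteq> C"
    and "inj_on a {1..n}" and "inj_on b {1..n}" and "a ` {1..n} \<inter> b ` {1..n} = {}"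
    and "D = (\<Sum>i=1..n. frag_of (a i)) - (\<Sum>i=1..n. frag_of (b i))"
    and "group.ord (Pic (proj_variety C)) (divisor_class (proj_variety C) D) = 2"
    and "f \<in> function_field (proj_variety C) - {zero_rat (proj_variety C)}"
    and "divisor_of (proj_variety C) f = Poly_Mapping.lookup (frag_cmul 2 D)"
  shows "module.subspace rat_scale (invariant_cycles C n a b f) \<and>
         vector_space.dim rat_scale (invariant_cycles C n a b f) > 0"
proof
  show "module.subspace rat_scale (invariant_cycles C n a b f)"
    by (rule subspace_invariant_cycles)
next
  define S where "S = a ` {1..n} \<union> b ` {1..n}"
  define E where "E = coord_embeddings C n S"
  define \<epsilon> :: "'n proj \<Rightarrow> rat" where "\<epsilon> p = (if p \<in> a ` {1..n} then 1 else - 1)" for p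
  let ?Y = "curve_power C n"
  have finS: "finite S" and SC: "S \<subseteq> C"
    using assms(3,4) by (auto simp: S_def)
  have "a 1 \<in> a ` {1..n}" "b 1 \<in> b ` {1..n}" using assms(2) by auto
  then have ne: "a 1 \<in> C" "b 1 \<in> C" "a 1 \<noteq> b 1"
    using assms(3,4,7) by (blast, blast, metis IntI empty_iff)
  have finE: "finite E"
    unfolding E_def using finite_coord_embeddings[OF SC ne finS] .
  have \<epsilon>_simps: "\<epsilon> (a i) = 1" "\<epsilon> (b i) = - 1" if "i \<in> {1..n}" for i
  proof -
    have "b i \<notin> a ` {1..n}" using that assms(7) by blast
    then show "\<epsilon> (a i) = 1" "\<epsilon> (b i) = - 1" using that by (simp_all add: \<epsilon>_def)
  qed
  have few: "card {s \<in> S. \<epsilon> s = 1} \<le> n" "card {s \<in> S. \<epsilon> s = - 1} \<le> n"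
  proof -
    have "{s \<in> S. \<epsilon> s = 1} \<subseteq> a ` {1..n}" "{s \<in> S. \<epsilon> s = - 1} \<subseteq> b ` {1..n}"
      by (auto simp: S_def \<epsilon>_def split: if_splits)
    then show "card {s \<in> S. \<epsilon> s = 1} \<le> n" "card {s \<in> S. \<epsilon> s = - 1} \<le> n"
      using surj_card_le[of "{1..n}" _ a] surj_card_le[of "{1..n}" _ b] by auto
  qed
  have S0: "S \<noteq> {}" and sgn: "\<epsilon> s = 1 \<or> \<epsilon> s = - 1" for s
    using assms(2) by (auto simp: S_def \<epsilon>_def)
  obtain \<mu> where \<mu>: "invariant_word_cycle S \<epsilon> n \<mu>" and
    nz: "\<exists>w. w ` {..n} \<subseteq> insert None (Some ` S) \<and> None \<in> w ` {..n} \<and> \<mu> w \<noteq> 0"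
    using exists_invariant_word_cycle[OF assms(2) finS S0 sgn few] by blast
  have loc: "\<mu> w = \<mu> w'" if "\<forall>j\<le>n. w j = w' j" for w w'
    using \<mu> that unfolding invariant_word_cycle_def by blast
  have sym: "\<mu> (w \<circ> \<sigma>) = \<mu> w" if "\<sigma> permutes {..n}" for \<sigma> w
    using \<mu> that unfolding invariant_word_cycle_def by blast
  have rel: "\<mu> (map_option \<tau> \<circ> w) = \<mu> w"
    if "\<kappa> \<in> {1, - 1}" "inj_on \<tau> S" "\<forall>s\<in>S. \<epsilon> (\<tau> s) = \<kappa> * \<epsilon> s" "w ` {..n} \<subseteq> insert None (Some ` S)" for \<tau> \<kappa> w
    using \<mu> that unfolding invariant_word_cycle_def by meson
  have cyc: "word_boundary S \<epsilon> n \<mu> x = 0" if "x ` {..n} \<subseteq> S" for x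
    using \<mu> that unfolding invariant_word_cycle_def by blast
  define m where "m e = \<mu> (word_of C e)" for e
  have m_relabel: "m (relabel C n \<tau> e) = m e"
    if "e \<in> E" "\<kappa> \<in> {1, - 1}" "inj_on \<tau> S" "\<forall>s\<in>S. \<epsilon> (\<tau> s) = \<kappa> * \<epsilon> s" for \<tau> \<kappa> e
  proof -
    have e: "e \<in> coord_embeddings C n S" using that(1) by (simp add: E_def)
    have "m (relabel C n \<tau> e) = \<mu> (map_option \<tau> \<circ> word_of C e)"
      unfolding m_def by (rule loc) (simp add: word_of_relabel[OF SC ne e])
    also have "\<dots> = m e"
      unfolding m_def by (rule rel[OF that(2,3,4) word_of_coord_embedding(2)[OF SC ne e]])
    finally show ?thesis .
  qed
  have inv: "invariant_coefficients C n a b E m"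
    unfolding invariant_coefficients_def
  proof (intro ballI conjI allI impI)
    fix e assume e: "e \<in> E"
    fix \<sigma> :: "nat \<Rightarrow> nat"
    show "m (permute_factors C \<sigma> e) = m e" if "\<sigma> permutes {..n}"
      using sym[OF permutes_inv[OF that]] by (simp add: m_def word_of_permute_factors[OF SC ne])
    assume \<sigma>: "\<sigma> permutes {1..n}"
    have im: "\<sigma> i \<in> {1..n}" if "i \<in> {1..n}" for i using permutes_in_image[OF \<sigma>] that by blast
    show "m (relabel C n (permute_family {1..n} a \<sigma>) e) = m e"
    proof (rule m_relabel[OF e, of 1]; (rule ballI)?)
      fix s assume "s \<in> S"
      then show "\<epsilon> (permute_family {1..n} a \<sigma> s) = 1 * \<epsilon> s"
        using permute_family_image_iff[OF assms(5) \<sigma>, of s] by (simp add: \<epsilon>_def)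
    qed (rule insertI1, rule inj_on_subset[OF inj_permute_family[OF assms(5) \<sigma>] subset_UNIV])
    show "m (relabel C n (permute_family {1..n} b \<sigma>) e) = m e"
    proof (rule m_relabel[OF e, of 1]; (rule ballI)?)
      fix s assume "s \<in> S"
      then consider i where "i \<in> {1..n}" "s = a i" | i where "i \<in> {1..n}" "s = b i"
        by (auto simp: S_def)
      then show "\<epsilon> (permute_family {1..n} b \<sigma> s) = 1 * \<epsilon> s"
      proof cases
        case 1
        then have "s \<notin> b ` {1..n}" using assms(7) by blast
        then show ?thesis by (simp add: permute_family_apply)
      next
        case 2
        then show ?thesis
          using \<epsilon>_simps(2)[of i] \<epsilon>_simps(2)[of "\<sigma> i"] im[of i] permute_family_apply(1)[OF assms(6), of i \<sigma>] by simp
      qed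
    qed (rule insertI1, rule inj_on_subset[OF inj_permute_family[OF assms(6) \<sigma>] subset_UNIV])
  next
    fix e assume e: "e \<in> E"
    show "m (relabel C n (switch_families {1..n} a b) e) = m e"
    proof (rule m_relabel[OF e, of "- 1"]; (rule ballI)?)
      show "inj_on (switch_families {1..n} a b) S"
        unfolding S_def using assms(5-7) by (rule inj_on_switch_families)
      fix s assume "s \<in> S"
      then consider i where "i \<in> {1..n}" "s = a i" | i where "i \<in> {1..n}" "s = b i"
        by (auto simp: S_def)
      then show "\<epsilon> (switch_families {1..n} a b s) = - 1 * \<epsilon> s"
      proof cases
        case 1
        then show ?thesis
          using switch_families_apply(1)[OF assms(5) 1(1), of b] \<epsilon>_simps[OF 1(1)] by simp
      next
        case 2
        then show ?thesis
          using switch_families_apply(2)[OF assms(6,7) 2(1)] \<epsilon>_simps[OF 2(1)] by simp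
      qed
    qed simp
  qed
  have D: "rat_of_int (divisor_of (proj_variety C) f p) = (if p \<in> S then 2 * \<epsilon> p else 0)" for p
    unfolding assms(11) assms(8)
    using lookup_sum_frag_of[OF _ assms(5), of p] lookup_sum_frag_of[OF _ assms(6), of p] assms(7)
    by (auto simp: lookup_minus S_def \<epsilon>_def)
  have div: "of_int (divisor_of (induced ?Y (e ` C)) (transport_rat (proj_variety C) ?Y e f) x)
      = 2 * (\<Sum>r\<in>S. if e r = x then \<epsilon> r else 0)" if e: "e \<in> E" for e x
  proof -
    have emb: "closed_embedding (proj_variety C) ?Y e"
      using e by (simp add: E_def coord_embeddings_def)
    have inj: "inj_on e C"
    proof (rule inj_onI)
      obtain \<psi> where "\<forall>x\<in>C. \<psi> (e x) = x"
        using emb by (auto simp: closed_embedding_def isomorphism_def)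
      then show "r = s" if "r \<in> C" "s \<in> C" "e r = e s" for r s using that by metis
    qed
    show ?thesis
    proof (cases "x \<in> e ` C")
      case True
      then obtain p where p: "p \<in> C" "x = e p" by blast
      have "divisor_of (induced ?Y (e ` C)) (transport_rat (proj_variety C) ?Y e f) x = divisor_of (proj_variety C) f p"
        using divisor_of_transport_rat[OF emb, of f p] assms(10) p by simp
      moreover have "(\<Sum>r\<in>S. if e r = x then \<epsilon> r else 0) = (\<Sum>r\<in>S. if r = p then \<epsilon> r else 0)"
        using p SC inj_on_eq_iff[OF inj] by (intro sum.cong) auto
      ultimately show ?thesis using D[of p] finS by simp
    next
      case False
      then have "x \<notin> points (induced ?Y (e ` C))" by (simp add: points_induced)
      moreover have "(\<Sum>r\<in>S. if e r = x then \<epsilon> r else 0) = 0"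
        using False SC by (intro sum.neutral) auto
      ultimately show ?thesis by (simp add: divisor_of_def)
    qed
  qed
  have cycle: "higher_chow_cycle ?Y (embedding_sum C n f E m)"
    unfolding higher_chow_cycle_def
  proof
    fix x assume "x \<in> points ?Y"
    have eq: "boundary ?Y (embedding_sum C n f E m) x = 2 * (\<Sum>e\<in>E. m e * (\<Sum>r\<in>S. if e r = x then \<epsilon> r else 0))"
      by (simp add: boundary_embedding_sum div sum_distrib_left mult.left_commute cong: sum.cong)
    show "boundary ?Y (embedding_sum C n f E m) x = 0"
    proof (cases "x \<in> (\<Pi>\<^sub>E i\<in>{..n}. S)")
      case True
      have "(\<Sum>e\<in>E. m e * (\<Sum>r\<in>S. if e r = x then \<epsilon> r else 0)) = word_boundary S \<epsilon> n \<mu> x"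
        unfolding m_def E_def
        by (rule sum_embeddings_eq_word_boundary[OF SC ne finS True]) (erule loc)
      also have "\<dots> = 0" using True by (intro cyc) auto
      finally show ?thesis unfolding eq by simp
    next
      case False
      \<comment> \<open>If a coordinate of \<open>x\<close> lies outside \<open>S\<close>, no embedding takes a point of \<open>S\<close> to \<open>x\<close>.\<close>
      have "e r \<noteq> x" if e: "e \<in> E" and r: "r \<in> S" for e r
      proof
        assume er: "e r = x"
        have "e r j = (case word_of C e j of None \<Rightarrow> r | Some c \<Rightarrow> c)" if "j \<le> n" for j
          using arg_cong[OF word_of_coord_embedding(1)[OF SC ne e[unfolded E_def]], of "\<lambda>e. e r j"] r SC that
          by (simp add: coordinate_map_def subset_iff)
        then have "e r j \<in> S" if "j \<le> n" for j
          using word_of_coord_embedding(2)[OF SC ne e[unfolded E_def]] r that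
          by (force split: option.splits)
        moreover have "e r \<in> points ?Y"
          using e r SC by (auto simp: E_def coord_embeddings_def)
        ultimately have "e r \<in> (\<Pi>\<^sub>E i\<in>{..n}. S)"
          by (simp add: points_power_space PiE_iff)
        then show False using False er by simp
      qed
      then show ?thesis unfolding eq by (simp cong: sum.cong)
    qed
  qed
  have z: "embedding_sum C n f E m \<in> invariant_cycles C n a b f"
    using inv cycle by (auto simp: invariant_cycles_def E_def S_def)
  obtain w where w: "w ` {..n} \<subseteq> insert None (Some ` S)" "None \<in> w ` {..n}" "\<mu> w \<noteq> 0"
    using nz by blast
  define e0 where "e0 = coordinate_map C {..n} w"
  have e0: "e0 \<in> E"
    unfolding e0_def E_def using SC ne w(1,2) by (rule coordinate_map_in_coord_embeddings)
  let ?k = "\<lambda>e. (e ` C, transport_rat (proj_variety C) ?Y e f)"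
  have "Poly_Mapping.lookup (embedding_sum C n f E m) (?k e0) = (\<Sum>e\<in>E. if e = e0 then m e else 0)"
    unfolding embedding_sum_def lookup_sum
  proof (rule sum.cong)
    fix e assume "e \<in> E"
    then have "?k e = ?k e0 \<longleftrightarrow> e = e0"
      using inj_on_eq_iff[OF inj_on_image_coord_embeddings[OF SC ne, of n]] e0 by (auto simp: E_def)
    then show "Poly_Mapping.lookup (Poly_Mapping.single (?k e) (m e)) (?k e0) = (if e = e0 then m e else 0)"
      by (simp only: lookup_single when_def)
  qed simp
  also have "\<dots> = m e0" using finE e0 by simp
  also have "m e0 = \<mu> w"
    unfolding m_def e0_def by (rule loc) (simp add: word_of_coordinate_map[OF SC ne])
  finally have "embedding_sum C n f E m \<noteq> 0" using w(3) by auto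
  moreover have "invariant_cycles C n a b f \<subseteq> range (embedding_sum C n f E)"
    unfolding invariant_cycles_def Let_def E_def S_def by auto
  then have "Poly_Mapping.keys z \<subseteq> ?k ` E" if "z \<in> invariant_cycles C n a b f" for z
    using keys_embedding_sum that by blast
  ultimately show "vector_space.dim rat_scale (invariant_cycles C n a b f) > 0"
    using finE z by (intro dim_pos_rat_scale[of "?k ` E"]) auto
qed

end
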